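(* Assume that $\mathcal{D}(A)\subset\mathcal{D}(Q^{-1/2})$, $|(-A)^{1/2}Q^{1/2}|_{\mathcal{L}_2(H)}<\infty$ and $|Q^{-1/2}(-A)^{-1}|_{\mathcal{L}(H)}<\infty$. Assume that $F\colon H\to H$ is Fréchet differentiable and that there exist $L_F,L>0$ such that $|F(u)-F(v)|\le L_F|u-v|$ for $u,v\in H$, $|F(u)|_{\dot H^1}\le L(1+|u|_{\dot H^1})$ for $u\in\dot H^1$, and $|F'(u)v|_{\dot H^2}\le L(1+|u|_{\dot H^2}^2)|v|_{\dot H^2}$ for $u,v\in\dot H^2$. Assume moreover that $F(0)=0$ and $L_F<\lambda_1$, and let $\tau_0>0$ satisfy $\frac{e^{\lambda_1\tau_0}-1}{\lambda_1\tau_0}=\frac{\lambda_1+L_F}{2L_F}$. If $F\equiv0$, then the fully discrete accelerated exponential Euler method weakly asymptotically preserves the large deviations principle of the invariant measures $\{\mu^\varepsilon\}_{\varepsilon>0}$, that is: for any $\kappa>0$ and any $u\in H$ with $V(u)<\infty$, there exist $n\in\mathbb{N}^+$, $\tau\in(0,\tau_0]$ and $u_{n,\tau}\in H_n$ such that $$|u-u_{n,\tau}|<\kappa,\qquad |V(u)-V^{n,\tau}(u_{n,\tau})|<\kappa.$$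
   Context: $H:=L^2((0,1);\mathbb{R})$ with inner product $\langle\cdot,\cdot\rangle$ and norm $|\cdot|$; $\mathcal{L}(H)$ and $\mathcal{L}_2(H)$ are the bounded and the Hilbert–Schmidt operators on $H$. $A$ is the Dirichlet Laplacian on $(0,1)$, $\mathcal{D}(A)=H_0^1\cap H^2$; $e_i(\xi)=\sqrt2\sin(i\pi\xi)$ is an orthonormal basis of $H$ with $-Ae_i=\lambda_ie_i$, $\lambda_i=\pi^2i^2$. For $\gamma\in\mathbb{R}$, $\dot H^\gamma:=\mathcal{D}((-A)^{\gamma/2})$ with norm $|u|_{\dot H^\gamma}=|(-A)^{\gamma/2}u|$. $Q$ is a self-adjoint, positive definite bounded linear operator on $H$ with $Qe_i=q_ie_i$, $q_i>0$; $Q^{-1/2}\colon Q^{1/2}(H)\to H$ is the inverse of $Q^{1/2}$ and $\mathcal{D}(Q^{-1/2})=Q^{1/2}(H)$. $\mu^\varepsilon$ is an invariant measure of the SPDE $dX=(AX+F(X))dt+\varepsilon Q^{1/2}dW$ on $H$ ($W$ a cylindrical Wiener process); the family $\{\mu^\varepsilon\}$ satisfies a large deviations principle on $H$ with rate $1/\varepsilon^2$ and good rate function $$V(u)=\inf\{I_{0,T}^0(z):T>0,\ z\in C([0,T];H),\ z(0)=0,\ z(T)=u\},\quad u\in H,$$ where $I_{0,T}^x(z)=\tfrac12\inf\{|\varphi|_{L^2(0,T;H)}^2:\varphi\in L^2(0,T;H),\ z_{0,x}^\varphi=z\}$ and $z_{0,x}^\varphi$ is the mild solution of $\frac{dz}{dt}=Az+F(z)+Q^{1/2}\varphi$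 on $(0,T]$, $z(0)=x$. For $n\in\mathbb{N}^+$: $H_n:=\mathrm{span}\{e_1,\dots,e_n\}$, $P_n$ is the orthogonal projection of $H$ onto $H_n$, $A_n:=P_nA$ (on $H_n$), $F_n:=P_nF$, $Q_n^{1/2}:=P_nQ^{1/2}$. The fully discrete method with stepsize $\tau$ (continuous-time form) is $dY(t)=(A_nY(t)+F_n(Y(\tau\lfloor t/\tau\rfloor)))dt+\varepsilon Q_n^{1/2}d(P_nW)(t)$. The rate function of its invariant measures is $$V^{n,\tau}(u)=\inf\{I_{0,T}^{n,\tau,0}(z):T>0,\ z\in C([0,T];H_n),\ z(0)=0,\ z(T)=u\},\quad u\in H_n,$$ where $I_{0,T}^{n,\tau,y}(z)=\tfrac12\inf\{|\phi|_{L^2(0,T;H)}^2:\phi\in L^2(0,T;H_n),\ z_{0,y}^{n,\tau,\phi}=z\}$ and $z_{0,y}^{n,\tau,\phi}$ is the mild solution of $\frac{dz(t)}{dt}=A_nz(t)+F_n(z(\tau\lfloor t/\tau\rfloor))+Q_n^{1/2}\phi(t)$, $z(0)=y$. All infima over the empty set are $+\infty$. *)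

theory Defs
  imports "HOL-Analysis.Analysis"
begin

section \<open>The Hilbert space $L^2((0,1);\mathbb{R})$\<close>

abbreviation unit_leb :: "real measure" where
  "unit_leb \<equiv> lebesgue_on {0<..<1}"

definition sq_integrable :: "(real \<Rightarrow> real) \<Rightarrow> bool" where
  "sq_integrable f \<longleftrightarrow> f \<in> borel_measurable unit_leb \<and> integrable unit_leb (\<lambda>x. (f x)\<^sup>2)"

lemma finite_measure_unit_leb: "finite_measure unit_leb"
  by (rule finite_measure_lebesgue_on) simp

lemma sq_integrable_mult:
  assumes "sq_integrable f" "sq_integrable g"
  shows "integrable unit_leb (\<lambda>x. f x * g x)"
proof -
  have [measurable]: "f \<in> borel_measurable unit_leb" "g \<in> borel_measurable unit_leb"
    using assms by (auto simp: sq_integrable_def)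
  have "integrable unit_leb (\<lambda>x. (f x)\<^sup>2 + (g x)\<^sup>2)"
    using assms by (auto simp: sq_integrable_def)
  then show ?thesis
  proof (rule Bochner_Integration.integrable_bound)
    have "\<bar>a * b\<bar> \<le> a\<^sup>2 + b\<^sup>2" for a b :: real
      using sum_squares_bound[of "\<bar>a\<bar>" "\<bar>b\<bar>"] mult_nonneg_nonneg[of "\<bar>a\<bar>" "\<bar>b\<bar>"]
      unfolding abs_mult power2_abs by linarith
    then show "AE x in unit_leb. norm (f x * g x) \<le> norm ((f x)\<^sup>2 + (g x)\<^sup>2)"
      by simp
  qed simp
qed

lemma sq_integrable_add:
  assumes "sq_integrable f" "sq_integrable g"
  shows "sq_integrable (\<lambda>x. f x + g x)"
  using sq_integrable_mult[OF assms] assms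
  by (auto simp: sq_integrable_def power2_sum mult.assoc)

lemma sq_integrable_scale: "sq_integrable f \<Longrightarrow> sq_integrable (\<lambda>x. c * f x)"
  by (auto simp: sq_integrable_def power_mult_distrib)

lemma sq_integrable_minus: "sq_integrable f \<Longrightarrow> sq_integrable (\<lambda>x. - f x)"
  using sq_integrable_scale[of f "-1"] by simp

lemma sq_integrable_diff:
  "sq_integrable f \<Longrightarrow> sq_integrable g \<Longrightarrow> sq_integrable (\<lambda>x. f x - g x)"
  using sq_integrable_add[of f "\<lambda>x. - g x"] sq_integrable_minus[of g] by simp

lemma sq_integrable_zero: "sq_integrable (\<lambda>x. 0)"
  by (simp add: sq_integrable_def)

lemma sq_integrable_bounded:
  assumes "f \<in> borel_measurable unit_leb" "\<And>x. \<bar>f x\<bar> \<le> B"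
  shows "sq_integrable f"
  unfolding sq_integrable_def
proof
  have [measurable]: "f \<in> borel_measurable unit_leb" by fact
  have "(f x)\<^sup>2 \<le> B\<^sup>2" for x
    using power_mono[OF assms(2)[of x], of 2] by simp
  then show "integrable unit_leb (\<lambda>x. (f x)\<^sup>2)"
    by (intro finite_measure.integrable_const_bound[OF finite_measure_unit_leb, of _ "B\<^sup>2"]) auto
qed (fact assms)

quotient_type L2 = "real \<Rightarrow> real" / partial:
  "\<lambda>f g. sq_integrable f \<and> sq_integrable g \<and> (AE x in unit_leb. f x = g x)"
proof (rule part_equivpI)
  show "\<exists>f. sq_integrable f \<and> sq_integrable f \<and> (AE x in unit_leb. f x = f x)"
    using sq_integrable_zero by auto
qed (auto intro!: sympI transpI elim: AE_mp)

instantiation L2 :: real_inner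
begin

lift_definition zero_L2 :: L2 is "\<lambda>x. 0"
  by (simp add: sq_integrable_zero)

lift_definition plus_L2 :: "L2 \<Rightarrow> L2 \<Rightarrow> L2" is "\<lambda>f g x. f x + g x"
  by (auto intro: sq_integrable_add)

lift_definition minus_L2 :: "L2 \<Rightarrow> L2 \<Rightarrow> L2" is "\<lambda>f g x. f x - g x"
  by (auto intro: sq_integrable_diff)

lift_definition uminus_L2 :: "L2 \<Rightarrow> L2" is "\<lambda>f x. - f x"
  by (auto intro: sq_integrable_minus)

lift_definition scaleR_L2 :: "real \<Rightarrow> L2 \<Rightarrow> L2" is "\<lambda>c f x. c * f x"
  by (auto intro: sq_integrable_scale)

lift_definition inner_L2 :: "L2 \<Rightarrow> L2 \<Rightarrow> real" is "\<lambda>f g. LINT x|unit_leb. f x * g x"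
proof -
  fix f g h k
  assume *: "sq_integrable f \<and> sq_integrable g \<and> (AE x in unit_leb. f x = g x)"
    "sq_integrable h \<and> sq_integrable k \<and> (AE x in unit_leb. h x = k x)"
  then have "AE x in unit_leb. f x * h x = g x * k x"
    by (auto elim: AE_mp)
  moreover have "integrable unit_leb (\<lambda>x. f x * h x)" "integrable unit_leb (\<lambda>x. g x * k x)"
    using * by (auto intro: sq_integrable_mult)
  ultimately show "(LINT x|unit_leb. f x * h x) = (LINT x|unit_leb. g x * k x)"
    by (intro integral_cong_AE) auto
qed

definition "norm (u::L2) = sqrt (inner u u)"
definition "sgn (u::L2) = scaleR (inverse (norm u)) u"
definition "dist (u::L2) v = norm (u - v)"
definition "uniformity = (INF e\<in>{0<..}. principal {(x::L2, y). dist x y < e})"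
definition "open (U::L2 set) \<longleftrightarrow> (\<forall>x\<in>U. \<forall>\<^sub>F (x', y) in uniformity. x' = x \<longrightarrow> y \<in> U)"

instance
proof
  fix u v w :: L2 and a b :: real
  show "u + v + w = u + (v + w)" by transfer (auto intro!: sq_integrable_add)
  show "u + v = v + u" by transfer (auto intro!: sq_integrable_add simp: add.commute)
  show "0 + u = u" by transfer auto
  show "- u + u = 0" by transfer (auto simp: sq_integrable_zero)
  show "u - v = u + - v"
    by transfer (auto intro!: sq_integrable_diff)
  show "a *\<^sub>R (u + v) = a *\<^sub>R u + a *\<^sub>R v"
    by transfer (auto intro!: sq_integrable_add sq_integrable_scale simp: distrib_left)
  show "(a + b) *\<^sub>R u = a *\<^sub>R u + b *\<^sub>R u"
    by transfer (auto intro!: sq_integrable_add sq_integrable_scale simp: distrib_right)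
  show "a *\<^sub>R b *\<^sub>R u = (a * b) *\<^sub>R u"
    by transfer (auto intro!: sq_integrable_scale simp: mult.assoc)
  show "1 *\<^sub>R u = u" by transfer auto
  show "u \<bullet> v = v \<bullet> u" by transfer (simp add: mult.commute)
  show "(u + v) \<bullet> w = u \<bullet> w + v \<bullet> w"
    by transfer (simp add: distrib_right sq_integrable_mult)
  show "a *\<^sub>R u \<bullet> v = a * (u \<bullet> v)"
    by transfer (simp add: mult.assoc)
  show "0 \<le> u \<bullet> u" by transfer simp
  show "u \<bullet> u = 0 \<longleftrightarrow> u = 0"
  proof transfer
    fix f assume "sq_integrable f \<and> sq_integrable f \<and> (AE x in unit_leb. f x = f x)"
    then have f: "sq_integrable f" by simp
    have "(LINT x|unit_leb. f x * f x) = 0 \<longleftrightarrow> (AE x in unit_leb. f x * f x = 0)"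
      using sq_integrable_mult[OF f f] by (intro integral_nonneg_eq_0_iff_AE) auto
    then show "(LINT x|unit_leb. f x * f x) = 0 \<longleftrightarrow>
        sq_integrable f \<and> sq_integrable (\<lambda>x. 0) \<and> (AE x in unit_leb. f x = 0)"
      using f by (simp add: sq_integrable_zero)
  qed
qed (simp_all add: norm_L2_def sgn_L2_def dist_L2_def uniformity_L2_def open_L2_def)

end

lemma sq_integrable_rep: "sq_integrable (rep_L2 u)"
  using Quotient_rep_reflp[OF Quotient_L2] by blast

lemma abs_rep_L2 [simp]: "abs_L2 (rep_L2 u) = u"
  by (rule Quotient_abs_rep[OF Quotient_L2])

lemma abs_L2_eq_iff:
  assumes "sq_integrable f" "sq_integrable g"
  shows "abs_L2 f = abs_L2 g \<longleftrightarrow> (AE x in unit_leb. f x = g x)"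
  using Quotient_rel[OF Quotient_L2, of f g] assms by auto

lemma rep_abs_L2: "sq_integrable f \<Longrightarrow> AE x in unit_leb. rep_L2 (abs_L2 f) x = f x"
  by (metis abs_L2_eq_iff abs_rep_L2 sq_integrable_rep)

lemma L2_cases: obtains f where "sq_integrable f" "u = abs_L2 f"
  by (metis abs_rep_L2 sq_integrable_rep)

lemma abs_L2_zero: "abs_L2 (\<lambda>x. 0) = 0"
  by (simp add: zero_L2.abs_eq)

lemma abs_L2_add:
  "sq_integrable f \<Longrightarrow> sq_integrable g \<Longrightarrow> abs_L2 f + abs_L2 g = abs_L2 (\<lambda>x. f x + g x)"
  by (subst plus_L2.abs_eq) auto

lemma abs_L2_diff:
  "sq_integrable f \<Longrightarrow> sq_integrable g \<Longrightarrow> abs_L2 f - abs_L2 g = abs_L2 (\<lambda>x. f x - g x)"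
  by (subst minus_L2.abs_eq) auto

lemma abs_L2_scale: "sq_integrable f \<Longrightarrow> c *\<^sub>R abs_L2 f = abs_L2 (\<lambda>x. c * f x)"
  by (subst scaleR_L2.abs_eq) auto

lemma inner_abs_L2:
  "sq_integrable f \<Longrightarrow> sq_integrable g \<Longrightarrow> abs_L2 f \<bullet> abs_L2 g = (LINT x|unit_leb. f x * g x)"
  by (subst inner_L2.abs_eq) auto

lemma norm_abs_L2: "sq_integrable f \<Longrightarrow> (norm (abs_L2 f))\<^sup>2 = (LINT x|unit_leb. (f x)\<^sup>2)"
  unfolding power2_norm_eq_inner by (simp add: inner_abs_L2 power2_eq_square)

lemma tendsto_abs_L2:
  assumes "\<And>n. sq_integrable (s n)" "sq_integrable f"
    and "(\<lambda>n. LINT x|unit_leb. (s n x - f x)\<^sup>2) \<longlonglongrightarrow> 0"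
  shows "(\<lambda>n. abs_L2 (s n)) \<longlonglongrightarrow> abs_L2 f"
proof -
  have "(\<lambda>n. (norm (abs_L2 (s n) - abs_L2 f))\<^sup>2) \<longlonglongrightarrow> 0"
    using assms by (simp add: abs_L2_diff norm_abs_L2 sq_integrable_diff)
  from tendsto_real_sqrt[OF this] have "(\<lambda>n. norm (abs_L2 (s n) - abs_L2 f)) \<longlonglongrightarrow> 0"
    by simp
  then show ?thesis
    by (simp add: tendsto_norm_zero_iff LIM_zero_iff)
qed

lemma L2_dominated_convergence:
  assumes s: "\<And>n. sq_integrable (s n)" and f: "sq_integrable f"
    and lim: "\<And>x. (\<lambda>n. s n x) \<longlonglongrightarrow> f x"
    and g: "sq_integrable g" and bd: "\<And>n x. \<bar>s n x - f x\<bar> \<le> g x"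
  shows "(\<lambda>n. abs_L2 (s n)) \<longlonglongrightarrow> abs_L2 f"
proof (rule tendsto_abs_L2[OF s f])
  have [measurable]: "f \<in> borel_measurable unit_leb" "\<And>n. s n \<in> borel_measurable unit_leb"
    using s f by (auto simp: sq_integrable_def)
  have "(\<lambda>n. LINT x|unit_leb. (s n x - f x)\<^sup>2) \<longlonglongrightarrow> (LINT x|unit_leb. 0)"
  proof (rule integral_dominated_convergence[where w = "\<lambda>x. (g x)\<^sup>2"])
    show "integrable unit_leb (\<lambda>x. (g x)\<^sup>2)" using g by (simp add: sq_integrable_def)
    show "AE x in unit_leb. (\<lambda>n. (s n x - f x)\<^sup>2) \<longlonglongrightarrow> 0"
    proof (rule AE_I2)
      fix x
      have "(\<lambda>n. (s n x - f x)\<^sup>2) \<longlonglongrightarrow> (f x - f x)\<^sup>2"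
        by (intro tendsto_intros lim)
      then show "(\<lambda>n. (s n x - f x)\<^sup>2) \<longlonglongrightarrow> 0" by simp
    qed
    show "AE x in unit_leb. norm ((s n x - f x)\<^sup>2) \<le> (g x)\<^sup>2" for n
      using power_mono[OF bd[of n], of _ 2] by simp
  qed simp_all
  then show "(\<lambda>n. LINT x|unit_leb. (s n x - f x)\<^sup>2) \<longlonglongrightarrow> 0" by simp
qed

lemma integral_abs_le_norm_L2:
  assumes f: "sq_integrable f"
  shows "(LINT x|unit_leb. \<bar>f x\<bar>) \<le> norm (abs_L2 f)"
proof -
  have [measurable]: "f \<in> borel_measurable unit_leb"
    using f by (simp add: sq_integrable_def)
  have one: "sq_integrable (\<lambda>x. 1)" by (rule sq_integrable_bounded[of _ 1]) auto
  have af: "sq_integrable (\<lambda>x. \<bar>f x\<bar>)"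
    using f by (auto simp: sq_integrable_def)
  have "measure unit_leb (space unit_leb) = 1"
    by (simp add: measure_restrict_space)
  then have n1: "norm (abs_L2 (\<lambda>x. 1)) = 1"
    by (simp add: norm_L2_def inner_abs_L2[OF one one])
  have "(LINT x|unit_leb. \<bar>f x\<bar>) = abs_L2 (\<lambda>x. \<bar>f x\<bar>) \<bullet> abs_L2 (\<lambda>x. 1)"
    by (simp add: inner_abs_L2[OF af one])
  also have "\<dots> \<le> norm (abs_L2 (\<lambda>x. \<bar>f x\<bar>)) * norm (abs_L2 (\<lambda>x. 1))"
    by (rule norm_cauchy_schwarz)
  also have "norm (abs_L2 (\<lambda>x. \<bar>f x\<bar>)) = norm (abs_L2 f)"
    by (simp add: norm_L2_def inner_abs_L2 f af)
  finally show ?thesis by (simp add: n1)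
qed

text \<open>Riesz--Fischer: completeness of \<^term>\<open>UNIV :: L2 set\<close>.\<close>

instance L2 :: complete_space
proof
  fix X :: "nat \<Rightarrow> L2" assume X: "Cauchy X"
  define s where "s n = rep_L2 (X n)" for n
  have s: "sq_integrable (s n)" for n by (simp add: s_def sq_integrable_rep)
  have Xs: "X n = abs_L2 (s n)" for n by (simp add: s_def)
  have [measurable]: "s n \<in> borel_measurable unit_leb" for n
    using s[of n] by (simp add: sq_integrable_def)
  have s1: "integrable unit_leb (s n)" for n
    using s[of n] unfolding sq_integrable_def
    by (elim conjE) (rule finite_measure.square_integrable_imp_integrable[OF finite_measure_unit_leb])
  have L1: "\<exists>N. \<forall>i\<ge>N. \<forall>j\<ge>N. (LINT x|unit_leb. norm (s i x - s j x)) < e" if "e > 0" for e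
  proof -
    obtain N where N: "\<forall>i\<ge>N. \<forall>j\<ge>N. norm (X i - X j) < e"
      using X[unfolded Cauchy_iff, rule_format, of e] \<open>e > 0\<close> by auto
    have "(LINT x|unit_leb. \<bar>s i x - s j x\<bar>) \<le> norm (X i - X j)" for i j
      using integral_abs_le_norm_L2[OF sq_integrable_diff[OF s[of i] s[of j]]]
      by (simp add: Xs abs_L2_diff s)
    then show ?thesis using N by (intro exI[of _ N]) (simp, meson le_less_trans)
  qed
  obtain r where r: "strict_mono r" and Cr: "AE x in unit_leb. Cauchy (\<lambda>i. s (r i) x)"
    by (rule cauchy_L1_AE_cauchy_subseq[OF s1 L1])
  define f where "f x = lim (\<lambda>i. s (r i) x)" for x
  have [measurable]: "f \<in> borel_measurable unit_leb" unfolding f_def by measurable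
  have lim: "AE x in unit_leb. (\<lambda>i. s (r i) x) \<longlonglongrightarrow> f x"
    using Cr unfolding f_def Cauchy_convergent_iff convergent_LIMSEQ_iff .
  have key: "integrable unit_leb (\<lambda>x. (f x - s n x)\<^sup>2) \<and>
      (LINT x|unit_leb. (f x - s n x)\<^sup>2) \<le> e\<^sup>2"
    if N: "\<forall>i\<ge>N. \<forall>j\<ge>N. norm (X i - X j) < e" and n: "n \<ge> N" for e N n
  proof -
    have ri: "r i \<ge> i" for i using r by (rule seq_suble)
    have "(\<integral>\<^sup>+x. ennreal ((f x - s n x)\<^sup>2) \<partial>unit_leb) \<le>
        (\<integral>\<^sup>+x. liminf (\<lambda>i. ennreal ((s (r i) x - s n x)\<^sup>2)) \<partial>unit_leb)"
    proof (rule nn_integral_mono_AE, use lim in eventually_elim)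
      fix x assume "(\<lambda>i. s (r i) x) \<longlonglongrightarrow> f x"
      then have "(\<lambda>i. ennreal ((s (r i) x - s n x)\<^sup>2)) \<longlonglongrightarrow> ennreal ((f x - s n x)\<^sup>2)"
        by (intro tendsto_intros)
      from lim_imp_Liminf[OF trivial_limit_sequentially this]
      show "ennreal ((f x - s n x)\<^sup>2) \<le> liminf (\<lambda>i. ennreal ((s (r i) x - s n x)\<^sup>2))"
        by simp
    qed
    also have "\<dots> \<le> liminf (\<lambda>i. \<integral>\<^sup>+x. ennreal ((s (r i) x - s n x)\<^sup>2) \<partial>unit_leb)"
      by (rule nn_integral_liminf) simp
    also have "\<dots> \<le> ennreal (e\<^sup>2)"
    proof (rule Liminf_le[OF trivial_limit_sequentially], rule eventually_sequentiallyI)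
      fix i assume "i \<ge> N"
      then have "norm (X (r i) - X n) \<le> e"
        using N n order_trans[OF \<open>i \<ge> N\<close> ri[of i]] by (intro less_imp_le) blast
      then have "(norm (X (r i) - X n))\<^sup>2 \<le> e\<^sup>2" by (simp add: power_mono)
      then have *: "(LINT x|unit_leb. (s (r i) x - s n x)\<^sup>2) \<le> e\<^sup>2"
        by (simp add: Xs abs_L2_diff s norm_abs_L2 sq_integrable_diff)
      have "integrable unit_leb (\<lambda>x. (s (r i) x - s n x)\<^sup>2)"
        using sq_integrable_diff[OF s s] by (simp add: sq_integrable_def)
      then have "(\<integral>\<^sup>+x. ennreal ((s (r i) x - s n x)\<^sup>2) \<partial>unit_leb) =
          ennreal (LINT x|unit_leb. (s (r i) x - s n x)\<^sup>2)"
        by (intro nn_integral_eq_integral) auto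
      with * show "(\<integral>\<^sup>+x. ennreal ((s (r i) x - s n x)\<^sup>2) \<partial>unit_leb) \<le> ennreal (e\<^sup>2)"
        by (simp add: ennreal_leI)
    qed
    finally have *: "(\<integral>\<^sup>+x. ennreal ((f x - s n x)\<^sup>2) \<partial>unit_leb) \<le> ennreal (e\<^sup>2)" .
    have "(\<integral>\<^sup>+x. ennreal ((f x - s n x)\<^sup>2) \<partial>unit_leb) < \<infinity>"
      using * by (rule le_less_trans) simp
    then have int: "integrable unit_leb (\<lambda>x. (f x - s n x)\<^sup>2)"
      by (intro integrableI_nonneg) auto
    moreover have "ennreal (LINT x|unit_leb. (f x - s n x)\<^sup>2) \<le> ennreal (e\<^sup>2)"
      using * nn_integral_eq_integral[OF int] by simp
    ultimately show ?thesis by (simp add: ennreal_le_iff)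
  qed
  obtain N0 where N0: "\<forall>i\<ge>N0. \<forall>j\<ge>N0. norm (X i - X j) < 1"
    using X[unfolded Cauchy_iff, rule_format, of 1] by auto
  have "sq_integrable (\<lambda>x. f x - s N0 x)"
    using key[OF N0 order_refl] by (simp add: sq_integrable_def)
  from sq_integrable_add[OF this s[of N0]] have f: "sq_integrable f" by simp
  have "X \<longlonglongrightarrow> abs_L2 f"
  proof (rule LIMSEQ_I)
    fix e :: real assume "e > 0"
    then obtain N where N: "\<forall>i\<ge>N. \<forall>j\<ge>N. norm (X i - X j) < e / 2"
      using X[unfolded Cauchy_iff, rule_format, of "e / 2"] \<open>e > 0\<close> by auto
    have "norm (X n - abs_L2 f) < e" if "n \<ge> N" for n
    proof -
      have "(norm (abs_L2 f - X n))\<^sup>2 \<le> (e / 2)\<^sup>2"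
        using key[OF N that] unfolding Xs abs_L2_diff[OF f s] norm_abs_L2[OF sq_integrable_diff[OF f s]]
        by blast
      then have "norm (abs_L2 f - X n) \<le> e / 2"
        by (rule power2_le_imp_le) (use \<open>e > 0\<close> in simp)
      also have "\<dots> < e" using \<open>e > 0\<close> by simp
      finally show ?thesis by (subst norm_minus_commute)
    qed
    then show "\<exists>N. \<forall>n\<ge>N. norm (X n - abs_L2 f) < e" by blast
  qed
  then show "convergent X" by (rule convergentI)
qed

instance L2 :: banach ..

text \<open>Separability: rational step functions are dense.\<close>

definition step_fun :: "(rat \<times> rat) list \<Rightarrow> real \<Rightarrow> real" where
  "step_fun xs t = (\<Sum>(a, c)\<leftarrow>xs. of_rat c * indicat_real {..<of_rat a} t)"

lemma step_fun_Nil: "step_fun [] t = 0"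
  and step_fun_append: "step_fun (xs @ ys) t = step_fun xs t + step_fun ys t"
  and step_fun_scale: "step_fun (map (\<lambda>(a, d). (a, c * d)) xs) t = of_rat c * step_fun xs t"
  by (simp_all add: step_fun_def)
    (induction xs, auto simp: of_rat_mult algebra_simps)

lemma sq_integrable_indicator:
  "A \<in> sets lebesgue \<Longrightarrow> sq_integrable (indicat_real A)"
proof (rule sq_integrable_bounded[of _ 1])
  assume "A \<in> sets lebesgue"
  then have "indicat_real A \<in> borel_measurable lebesgue" by simp
  then show "indicat_real A \<in> borel_measurable unit_leb" by (rule measurable_restrict_space1)
qed (simp add: indicator_def)

lemma sq_integrable_step_fun: "sq_integrable (step_fun xs)"
proof (induction xs)
  case Nil
  then show ?case by (simp add: step_fun_def[abs_def] sq_integrable_zero)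
next
  case (Cons p xs)
  obtain a c where p: "p = (a, c)" by fastforce
  have "sq_integrable (\<lambda>t. of_rat c * indicat_real {..<of_rat a} t + step_fun xs t)"
    by (intro sq_integrable_add Cons sq_integrable_scale sq_integrable_indicator) simp
  then show ?case by (simp add: step_fun_def[abs_def] p)
qed

definition step_cl :: "L2 set" where
  "step_cl = closure (range (\<lambda>xs. abs_L2 (step_fun xs)))"

lemma step_cl_add: "u \<in> step_cl \<Longrightarrow> v \<in> step_cl \<Longrightarrow> u + v \<in> step_cl"
proof -
  assume "u \<in> step_cl" "v \<in> step_cl"
  then obtain x y where x: "\<And>n. x n \<in> range (\<lambda>xs. abs_L2 (step_fun xs))" "x \<longlonglongrightarrow> u"
    and y: "\<And>n. y n \<in> range (\<lambda>xs. abs_L2 (step_fun xs))" "y \<longlonglongrightarrow> v"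
    unfolding step_cl_def closure_sequential by metis
  have "x n + y n \<in> range (\<lambda>xs. abs_L2 (step_fun xs))" for n
  proof -
    obtain xs ys where "x n = abs_L2 (step_fun xs)" "y n = abs_L2 (step_fun ys)"
      using x(1)[of n] y(1)[of n] by auto
    then have "x n + y n = abs_L2 (step_fun (xs @ ys))"
      by (simp add: abs_L2_add sq_integrable_step_fun step_fun_append[abs_def])
    then show ?thesis by blast
  qed
  then show ?thesis
    unfolding step_cl_def closure_sequential using tendsto_add[OF x(2) y(2)]
    by (intro exI[of _ "\<lambda>n. x n + y n"]) simp
qed

lemma step_cl_scale: "u \<in> step_cl \<Longrightarrow> c *\<^sub>R u \<in> step_cl"
proof -
  assume "u \<in> step_cl"
  then obtain x where x: "\<And>n. x n \<in> range (\<lambda>xs. abs_L2 (step_fun xs))" "x \<longlonglongrightarrow> u"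
    unfolding step_cl_def closure_sequential by metis
  have "c \<in> closure \<rat>" by (simp add: Rats_closure_real)
  then obtain q where q: "\<And>n. q n \<in> \<rat>" "q \<longlonglongrightarrow> c"
    unfolding closure_sequential by metis
  have "q n *\<^sub>R x n \<in> range (\<lambda>xs. abs_L2 (step_fun xs))" for n
  proof -
    obtain xs d where "x n = abs_L2 (step_fun xs)" "q n = of_rat d"
      using x(1)[of n] q(1)[of n] by (auto elim: Rats_cases)
    then have "q n *\<^sub>R x n = abs_L2 (step_fun (map (\<lambda>(a, e). (a, d * e)) xs))"
      by (simp add: abs_L2_scale sq_integrable_step_fun step_fun_scale[abs_def])
    then show ?thesis by blast
  qed
  then show ?thesis
    unfolding step_cl_def closure_sequential using tendsto_scaleR[OF q(2) x(2)]
    by (intro exI[of _ "\<lambda>n. q n *\<^sub>R x n"]) simp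
qed

lemma step_cl_lim: "(\<And>n. x n \<in> step_cl) \<Longrightarrow> x \<longlonglongrightarrow> u \<Longrightarrow> u \<in> step_cl"
  using closed_sequentially[of step_cl x u] by (simp add: step_cl_def)

lemma step_cl_lessThan: "abs_L2 (indicat_real {..<a}) \<in> step_cl"
proof -
  have "\<exists>q\<in>\<rat>. a < q \<and> q < a + inverse (real (Suc n))" for n
    by (rule Rats_dense_in_real) simp
  then obtain q where q: "\<And>n. q n \<in> \<rat>" "\<And>n. a < q n" "\<And>n. q n < a + inverse (real (Suc n))"
    by metis
  have "(\<lambda>n. a + inverse (real (Suc n))) \<longlonglongrightarrow> a + 0"
    by (intro tendsto_intros LIMSEQ_inverse_real_of_nat)
  then have qa: "q \<longlonglongrightarrow> a"
    by (intro tendsto_sandwich[of "\<lambda>_. a" q _ "\<lambda>n. a + inverse (real (Suc n))"]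
        always_eventually allI less_imp_le q) simp_all
  have "(\<lambda>n. abs_L2 (indicat_real {..<q n})) \<longlonglongrightarrow> abs_L2 (indicat_real {..a})"
  proof (rule L2_dominated_convergence[where g = "\<lambda>x. 1"])
    show "(\<lambda>n. indicat_real {..<q n} x) \<longlonglongrightarrow> indicat_real {..a} x" for x
    proof (cases "x \<le> a")
      case True
      then have "indicat_real {..<q n} x = indicat_real {..a} x" for n
        using q(2)[of n] by (auto simp: indicator_def)
      then show ?thesis by simp
    next
      case False
      then have "\<forall>\<^sub>F n in sequentially. q n < x"
        using order_tendstoD(2)[OF qa, of x] by simp
      then have "\<forall>\<^sub>F n in sequentially. indicat_real {..a} x = indicat_real {..<q n} x"
        by eventually_elim (use False in \<open>auto simp: indicator_def\<close>)
      then show ?thesis by (rule Lim_transform_eventually[OF tendsto_const])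
    qed
    show "sq_integrable (\<lambda>x. 1)" by (rule sq_integrable_bounded[of _ 1]) auto
  qed (auto intro: sq_integrable_indicator simp: indicator_def)
  moreover have "abs_L2 (indicat_real {..<q n}) \<in> step_cl" for n
  proof -
    obtain p where "q n = of_rat p" using q(1)[of n] by (auto elim: Rats_cases)
    then have "indicat_real {..<q n} = step_fun [(p, 1)]" by (auto simp: step_fun_def)
    then show ?thesis unfolding step_cl_def using closure_subset by fastforce
  qed
  ultimately have "abs_L2 (indicat_real {..a}) \<in> step_cl" by (metis step_cl_lim)
  moreover have "AE x in unit_leb. indicat_real {..a} x = indicat_real {..<a} x"
  proof -
    have "AE x in lebesgue. x \<noteq> a"
      by (rule AE_completion) (rule AE_lborel_singleton)
    then have "AE x in lebesgue. x \<in> {0<..<1} \<longrightarrow> indicat_real {..a} x = indicat_real {..<a} x"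
      by eventually_elim (auto simp: indicator_def)
    then show ?thesis by (subst AE_restrict_space_iff) auto
  qed
  then have "abs_L2 (indicat_real {..a}) = abs_L2 (indicat_real {..<a})"
    by (subst abs_L2_eq_iff) (auto intro: sq_integrable_indicator)
  ultimately show ?thesis by simp
qed

lemma step_cl_UNIV: "abs_L2 (\<lambda>x. 1) \<in> step_cl"
proof -
  have "AE x in unit_leb. indicat_real {..<1} x = 1"
    by (rule AE_I2) (auto simp: indicator_def)
  then have "abs_L2 (indicat_real {..<1}) = abs_L2 (\<lambda>x. 1)"
    by (subst abs_L2_eq_iff)
      (auto intro: sq_integrable_indicator intro!: sq_integrable_bounded[of "\<lambda>x. 1" 1])
  then show ?thesis using step_cl_lessThan[of 1] by simp
qed

lemma zero_in_step_cl: "0 \<in> step_cl"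
  using step_cl_scale[OF step_cl_UNIV, of 0] by simp

lemma step_cl_borel:
  assumes "A \<in> sets borel"
  shows "abs_L2 (indicat_real A) \<in> step_cl"
proof -
  have 1: "sq_integrable (\<lambda>x. 1)" by (rule sq_integrable_bounded[of _ 1]) auto
  define G where "G = range (\<lambda>a::real. {..<a})"
  have G: "sets borel = sigma_sets UNIV G"
    unfolding G_def by (subst borel_Iio) (simp add: sets_measure_of)
  have I: "Int_stable G"
    unfolding Int_stable_def G_def
  proof (clarify)
    fix a b :: real
    have "{..<a} \<inter> {..<b} = {..<min a b}" by auto
    then show "{..<a} \<inter> {..<b} \<in> range lessThan" by blast
  qed
  have GP: "G \<subseteq> Pow UNIV" by simp
  have sm: "sq_integrable (indicat_real B)" if "B \<in> sigma_sets UNIV G" for B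
    using that by (intro sq_integrable_indicator) (auto simp: G[symmetric])
  have "A \<in> sigma_sets UNIV G" using assms by (simp add: G)
  then show ?thesis
  proof (induction rule: sigma_sets_induct_disjoint[OF I GP, consumes 1, case_names basic empty compl union])
    case (basic A)
    then show ?case using step_cl_lessThan by (auto simp: G_def)
  next
    case empty
    show ?case using zero_in_step_cl by (simp add: abs_L2_zero)
  next
    case (compl A)
    have "abs_L2 (indicat_real (UNIV - A)) = abs_L2 (\<lambda>x. 1) + (-1) *\<^sub>R abs_L2 (indicat_real A)"
      using sm[OF compl(1)]
      by (simp only: abs_L2_scale abs_L2_add 1 sq_integrable_scale)
        (auto intro!: arg_cong[of _ _ abs_L2] simp: indicator_def)
    then show ?case
      using step_cl_add[OF step_cl_UNIV step_cl_scale[OF compl(2), of "-1"]] by simp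
  next
    case (union A)
    define U where "U n = (\<Union>i<n. A i)" for n
    have mU: "sq_integrable (indicat_real (U n))" for n
      using union(2) by (intro sq_integrable_indicator) (auto simp: U_def G[symmetric] image_subset_iff)
    have "abs_L2 (indicat_real (U n)) \<in> step_cl" for n
    proof (induction n)
      case 0
      show ?case using zero_in_step_cl by (simp add: U_def abs_L2_zero)
    next
      case (Suc n)
      have "A i \<inter> A n = {}" if "i < n" for i
        using union(1) that by (auto simp: disjoint_family_on_def)
      then have "U n \<inter> A n = {}" by (auto simp: U_def)
      then have "indicat_real (U n \<union> A n) = (\<lambda>x. indicat_real (U n) x + indicat_real (A n) x)"
        by (intro ext) (auto simp: indicator_def)
      moreover have "U (Suc n) = U n \<union> A n" by (auto simp: U_def lessThan_Suc)
      moreover have "sq_integrable (indicat_real (A n))"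
        using union(2) by (intro sm) auto
      ultimately have "abs_L2 (indicat_real (U (Suc n))) = abs_L2 (indicat_real (U n)) + abs_L2 (indicat_real (A n))"
        by (simp add: abs_L2_add[OF mU])
      then show ?case using step_cl_add[OF Suc union(3)] by simp
    qed
    moreover have "(\<lambda>n. abs_L2 (indicat_real (U n))) \<longlonglongrightarrow> abs_L2 (indicat_real (\<Union>(range A)))"
    proof (rule L2_dominated_convergence[OF mU _ _ 1])
      show "sq_integrable (indicat_real (\<Union>(range A)))"
        using union(2) by (intro sq_integrable_indicator) (auto simp: G[symmetric] image_subset_iff)
      show "(\<lambda>n. indicat_real (U n) x) \<longlonglongrightarrow> indicat_real (\<Union>(range A)) x" for x
        unfolding U_def by (rule LIMSEQ_indicator_UN)
    qed (auto simp: indicator_def)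
    ultimately show ?case by (rule step_cl_lim)
  qed
qed

lemma step_cl_lebesgue:
  assumes "A \<in> sets lebesgue"
  shows "abs_L2 (indicat_real A) \<in> step_cl"
proof -
  obtain S N N' where A: "A = S \<union> N" "N \<subseteq> N'" "N' \<in> null_sets lborel" "S \<in> sets lborel"
    using assms by (rule sets_completionE)
  have "AE x in lebesgue. x \<notin> N'"
    by (rule AE_completion) (rule AE_not_in[OF A(3)])
  then have "AE x in lebesgue. x \<in> {0<..<1} \<longrightarrow> indicat_real S x = indicat_real A x"
    by eventually_elim (use A in \<open>auto simp: indicator_def\<close>)
  then have "AE x in unit_leb. indicat_real S x = indicat_real A x"
    by (subst AE_restrict_space_iff) auto
  then have "abs_L2 (indicat_real S) = abs_L2 (indicat_real A)"
    using A(4) assms by (subst abs_L2_eq_iff) (auto intro!: sq_integrable_indicator)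
  then show ?thesis using step_cl_borel[of S] A(4) by simp
qed

lemma step_cl_simple:
  assumes f: "simple_function unit_leb f"
  shows "sq_integrable f \<and> abs_L2 f \<in> step_cl"
proof -
  have fin: "finite (f ` space unit_leb)" and
    m: "\<And>y. f -` {y} \<inter> space unit_leb \<in> sets unit_leb"
    using simple_functionD[OF f] by auto
  have m': "f -` {y} \<inter> space unit_leb \<in> sets lebesgue" for y
    using m[of y] by (simp add: sets_restrict_space_iff)
  have sum: "sq_integrable (\<lambda>x. \<Sum>y\<in>Y. y * indicat_real (f -` {y} \<inter> space unit_leb) x) \<and>
      abs_L2 (\<lambda>x. \<Sum>y\<in>Y. y * indicat_real (f -` {y} \<inter> space unit_leb) x) \<in> step_cl"
    if "finite Y" for Y
    using that
  proof induction
    case empty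
    show ?case using zero_in_step_cl by (simp add: sq_integrable_zero abs_L2_zero)
  next
    case (insert y Y)
    define g where "g x = (\<Sum>y\<in>Y. y * indicat_real (f -` {y} \<inter> space unit_leb) x)" for x
    define h where "h = indicat_real (f -` {y} \<inter> space unit_leb)"
    have h: "sq_integrable h" "abs_L2 h \<in> step_cl"
      unfolding h_def by (rule sq_integrable_indicator[OF m'], rule step_cl_lebesgue[OF m'])
    have g: "sq_integrable g" "abs_L2 g \<in> step_cl"
      using insert(3) unfolding g_def[abs_def] by blast+
    have eq: "(\<lambda>x. \<Sum>y\<in>insert y Y. y * indicat_real (f -` {y} \<inter> space unit_leb) x) =
        (\<lambda>x. y * h x + g x)"
      unfolding g_def h_def by (rule ext, rule sum.insert[OF insert(1,2)])
    have yh: "sq_integrable (\<lambda>x. y * h x)" using h(1) by (rule sq_integrable_scale)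
    have "abs_L2 (\<lambda>x. y * h x + g x) = y *\<^sub>R abs_L2 h + abs_L2 g"
      by (simp add: abs_L2_scale[OF h(1)] abs_L2_add[OF yh g(1)])
    then show ?case
      unfolding eq using sq_integrable_add[OF yh g(1)] step_cl_add[OF step_cl_scale[OF h(2), of y] g(2)]
      by metis
  qed
  define f' where "f' x = (\<Sum>y\<in>f ` space unit_leb. y * indicat_real (f -` {y} \<inter> space unit_leb) x)" for x
  have f': "sq_integrable f'" "abs_L2 f' \<in> step_cl"
    using sum[OF fin] unfolding f'_def[abs_def] by blast+
  have eq: "f x = f' x" if "x \<in> space unit_leb" for x
    unfolding f'_def
    by (subst simple_function_indicator_representation_banach[OF f that])
      (intro sum.cong refl, simp only: real_scaleR_def mult.commute)
  have fm: "f \<in> borel_measurable unit_leb" using f by (rule borel_measurable_simple_function)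
  have "integrable unit_leb (\<lambda>x. (f x)\<^sup>2) \<longleftrightarrow> integrable unit_leb (\<lambda>x. (f' x)\<^sup>2)"
    by (rule Bochner_Integration.integrable_cong) (auto simp: eq)
  then have sf: "sq_integrable f" using f' fm by (simp add: sq_integrable_def)
  moreover have "abs_L2 f = abs_L2 f'"
    by (subst abs_L2_eq_iff[OF sf f'(1)]) (rule AE_I2, rule eq)
  ultimately show ?thesis using f' by simp
qed

lemma step_cl_eq_UNIV: "step_cl = UNIV"
proof -
  have "u \<in> step_cl" for u
  proof (cases u rule: L2_cases)
    case (1 f)
    have [measurable]: "f \<in> borel_measurable unit_leb" using 1 by (simp add: sq_integrable_def)
    obtain F where F: "\<And>i. simple_function unit_leb (F i)"
      "\<And>x. x \<in> space unit_leb \<Longrightarrow> (\<lambda>i. F i x) \<longlonglongrightarrow> f x"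
      "\<And>i x. x \<in> space unit_leb \<Longrightarrow> dist (F i x) 0 \<le> 2 * dist (f x) 0"
      using borel_measurable_implies_sequence_metric[of f unit_leb 0] by (metis \<open>f \<in> borel_measurable unit_leb\<close>)
    have sF: "sq_integrable (F i)" and cF: "abs_L2 (F i) \<in> step_cl" for i
      using step_cl_simple[OF F(1)] by auto
    have [measurable]: "F i \<in> borel_measurable unit_leb" for i
      using sF[of i] by (simp add: sq_integrable_def)
    have "(\<lambda>i. abs_L2 (F i)) \<longlonglongrightarrow> abs_L2 f"
    proof (rule tendsto_abs_L2[OF sF 1(1)])
      have "(\<lambda>i. LINT x|unit_leb. (F i x - f x)\<^sup>2) \<longlonglongrightarrow> (LINT x|unit_leb. 0)"
      proof (rule integral_dominated_convergence[where w = "\<lambda>x. 9 * (f x)\<^sup>2"])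
        show "integrable unit_leb (\<lambda>x. 9 * (f x)\<^sup>2)" using 1 by (simp add: sq_integrable_def)
        show "AE x in unit_leb. (\<lambda>i. (F i x - f x)\<^sup>2) \<longlonglongrightarrow> 0"
        proof (rule AE_I2)
          fix x assume "x \<in> space unit_leb"
          then have "(\<lambda>i. (F i x - f x)\<^sup>2) \<longlonglongrightarrow> (f x - f x)\<^sup>2"
            by (intro tendsto_intros F)
          then show "(\<lambda>i. (F i x - f x)\<^sup>2) \<longlonglongrightarrow> 0" by simp
        qed
        show "AE x in unit_leb. norm ((F i x - f x)\<^sup>2) \<le> 9 * (f x)\<^sup>2" for i
        proof (rule AE_I2)
          fix x assume "x \<in> space unit_leb"
          from F(3)[OF this, of i] have "\<bar>F i x - f x\<bar> \<le> 3 * \<bar>f x\<bar>" by (simp add: dist_norm)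
          from power_mono[OF this, of 2] show "norm ((F i x - f x)\<^sup>2) \<le> 9 * (f x)\<^sup>2"
            by (simp add: power_mult_distrib)
        qed
      qed simp_all
      then show "(\<lambda>i. LINT x|unit_leb. (F i x - f x)\<^sup>2) \<longlonglongrightarrow> 0" by simp
    qed
    then show ?thesis unfolding 1(2) by (rule step_cl_lim[OF cF])
  qed
  then show ?thesis by auto
qed

instance L2 :: second_countable_topology
proof
  define D where "D = range (\<lambda>xs. abs_L2 (step_fun xs))"
  have D: "countable D" unfolding D_def by simp
  have dense: "closure D = UNIV" using step_cl_eq_UNIV by (simp add: D_def step_cl_def)
  define B where "B = (\<lambda>(d, n). ball d (inverse (real (Suc n)))) ` (D \<times> (UNIV :: nat set))"
  have "countable B" unfolding B_def using D by (intro countable_image countable_SIGMA) auto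
  moreover have "topological_basis B"
  proof (rule topological_basisI)
    show "open U" if "U \<in> B" for U using that by (auto simp: B_def)
    fix U :: "L2 set" and x assume "open U" "x \<in> U"
    then obtain e where e: "e > 0" "ball x e \<subseteq> U" by (meson openE)
    obtain n where n: "inverse (real (Suc n)) < e / 2"
      using reals_Archimedean[of "e / 2"] e by auto
    have "x \<in> closure D" by (simp add: dense)
    then obtain d where d: "d \<in> D" "dist d x < inverse (real (Suc n))"
      by (metis closure_approachable inverse_positive_iff_positive of_nat_0_less_iff zero_less_Suc)
    show "\<exists>V\<in>B. x \<in> V \<and> V \<subseteq> U"
    proof (intro bexI conjI)
      show "ball d (inverse (real (Suc n))) \<in> B" using d by (auto simp: B_def)
      show "x \<in> ball d (inverse (real (Suc n)))" using d by simp
      show "ball d (inverse (real (Suc n))) \<subseteq> U"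
      proof
        fix y assume "y \<in> ball d (inverse (real (Suc n)))"
        then have "dist x y < e" using d(2) n dist_triangle[of x y d] by (simp add: dist_commute)
        then show "y \<in> U" using e(2) by auto
      qed
    qed
  qed
  ultimately show "\<exists>B::L2 set set. countable B \<and> open = generate_topology B"
    by (metis topological_basis_imp_subbasis)
qed


section \<open>The Dirichlet Laplacian on $(0,1)$\<close>

text \<open>
  Weak derivatives are tested against compactly supported $C^1$ functions on $(0,1)$; since the
  candidates are in $L^2$, testing against $C_c^\infty$ functions gives the same notion.
\<close>

definition weak_deriv :: "L2 \<Rightarrow> L2 \<Rightarrow> bool" where
  "weak_deriv u v \<longleftrightarrow>
     (\<forall>\<phi> \<phi>'. (\<forall>x. (\<phi> has_real_derivative \<phi>' x) (at x)) \<longrightarrow> continuous_on UNIV \<phi>' \<longrightarrow>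
        (\<exists>K. compact K \<and> K \<subseteq> {0<..<1} \<and> (\<forall>x. x \<notin> K \<longrightarrow> \<phi> x = 0)) \<longrightarrow>
        (LINT x|unit_leb. rep_L2 u x * \<phi>' x) = - (LINT x|unit_leb. rep_L2 v x * \<phi> x))"

definition sobolev_H1 :: "L2 set" where
  "sobolev_H1 = {u. \<exists>v. weak_deriv u v}"

definition sobolev_H2 :: "L2 set" where
  "sobolev_H2 = {u. \<exists>v w. weak_deriv u v \<and> weak_deriv v w}"

text \<open>$H_0^1$: the continuous representative vanishes at both end points.\<close>

definition sobolev_H10 :: "L2 set" where
  "sobolev_H10 = {u \<in> sobolev_H1. \<exists>g. continuous_on {0..1} g \<and> g 0 = 0 \<and> g 1 = 0 \<and>
     (AE x in unit_leb. rep_L2 u x = g x)}"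

definition lap_dom :: "L2 set" where
  "lap_dom = sobolev_H10 \<inter> sobolev_H2"

text \<open>Only meaningful on \<^const>\<open>lap_dom\<close>; there the second weak derivative is unique.\<close>

definition lap :: "L2 \<Rightarrow> L2" where
  "lap u = (THE w. \<exists>v. weak_deriv u v \<and> weak_deriv v w)"

text \<open>
  \<open>e_basis i\<close> and \<open>eigval i\<close> are the eigenpairs $e_i$, $\lambda_i$ of $-A$ for $i \ge 1$; series over
  $i \ge 1$ are written with \<^const>\<open>Suc\<close> below.
\<close>

definition e_basis :: "nat \<Rightarrow> L2" where
  "e_basis i = abs_L2 (\<lambda>x. sqrt 2 * sin (real i * pi * x))"

definition eigval :: "nat \<Rightarrow> real" where
  "eigval i = pi\<^sup>2 * (real i)\<^sup>2"

text \<open>The eigenpairs: $e_i \in \mathcal{D}(A)$ and $-Ae_i = \lambda_i e_i$.\<close>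

definition test_pair :: "(real \<Rightarrow> real) \<Rightarrow> (real \<Rightarrow> real) \<Rightarrow> bool" where
  "test_pair \<phi> \<phi>' \<longleftrightarrow> (\<forall>x. (\<phi> has_real_derivative \<phi>' x) (at x)) \<and> continuous_on UNIV \<phi>' \<and>
     (\<exists>K. compact K \<and> K \<subseteq> {0<..<1} \<and> (\<forall>x. x \<notin> K \<longrightarrow> \<phi> x = 0))"

lemma weak_deriv_iff: "weak_deriv u v \<longleftrightarrow> (\<forall>\<phi> \<phi>'. test_pair \<phi> \<phi>' \<longrightarrow>
    (LINT x|unit_leb. rep_L2 u x * \<phi>' x) = - (LINT x|unit_leb. rep_L2 v x * \<phi> x))"
  unfolding weak_deriv_def test_pair_def by blast

lemma pos_part_sq_deriv:
  "((\<lambda>x::real. (max 0 x)\<^sup>2) has_real_derivative 2 * max 0 x) (at x)"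
proof -
  consider "x > 0" | "x < 0" | "x = 0" by linarith
  then show ?thesis
  proof cases
    case 1
    have "((\<lambda>x::real. x\<^sup>2) has_real_derivative 2 * max 0 x) (at x)"
      using 1 by (auto intro!: derivative_eq_intros)
    then show ?thesis
      by (rule has_field_derivative_transform_within_open[of _ _ _ "{0<..}"]) (use 1 in auto)
  next
    case 2
    have "((\<lambda>x::real. 0) has_real_derivative 2 * max 0 x) (at x)"
      using 2 by (auto intro!: derivative_eq_intros)
    then show ?thesis
      by (rule has_field_derivative_transform_within_open[of _ _ _ "{..<0}"]) (use 2 in auto)
  next
    case 3
    have "((\<lambda>h::real. max 0 h) \<longlongrightarrow> max 0 0) (at 0)" by (intro tendsto_intros)
    moreover have "(max 0 h)\<^sup>2 / h = max 0 h" for h :: real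
      by (cases "h > 0") (auto simp: power2_eq_square max_def)
    ultimately show ?thesis unfolding 3 DERIV_def by simp
  qed
qed

definition bump :: "real \<Rightarrow> nat \<Rightarrow> real \<Rightarrow> real" where
  "bump b n x = real n * ((max 0 (x - 1 / real n))\<^sup>2 * (max 0 (b - 1 / real n - x))\<^sup>2)"

definition bump' :: "real \<Rightarrow> nat \<Rightarrow> real \<Rightarrow> real" where
  "bump' b n x = real n * ((2 * max 0 (x - 1 / real n)) * (max 0 (b - 1 / real n - x))\<^sup>2 -
     (max 0 (x - 1 / real n))\<^sup>2 * (2 * max 0 (b - 1 / real n - x)))"

lemma bump_nonneg: "bump b n x \<ge> 0"
  by (simp add: bump_def)

lemma bump_deriv: "(bump b n has_real_derivative bump' b n x) (at x)"
proof -
  have 1: "((\<lambda>x. (max 0 (x - 1 / real n))\<^sup>2) has_real_derivative 2 * max 0 (x - 1 / real n) * 1) (at x)"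
    by (rule DERIV_chain2[OF pos_part_sq_deriv]) (auto intro!: derivative_eq_intros)
  have 2: "((\<lambda>x. (max 0 (b - 1 / real n - x))\<^sup>2) has_real_derivative
      2 * max 0 (b - 1 / real n - x) * (-1)) (at x)"
    by (rule DERIV_chain2[OF pos_part_sq_deriv]) (auto intro!: derivative_eq_intros)
  show ?thesis
    unfolding bump_def[abs_def] bump'_def
    by (rule DERIV_cong[OF DERIV_cmult[OF DERIV_mult[OF 1 2]]]) (simp add: algebra_simps)
qed

lemma test_pair_bump:
  assumes "b \<le> 1" "n > 0"
  shows "test_pair (\<lambda>x. bump b n x / (1 + bump b n x)) (\<lambda>x. bump' b n x / (1 + bump b n x)\<^sup>2)"
  unfolding test_pair_def
proof (intro conjI allI)
  have pos: "1 + bump b n x > 0" for x using bump_nonneg[of b n x] by simp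
  show "((\<lambda>x. bump b n x / (1 + bump b n x)) has_real_derivative
      bump' b n x / (1 + bump b n x)\<^sup>2) (at x)" for x
    using pos[of x]
    by (auto intro!: derivative_eq_intros bump_deriv simp: field_simps power2_eq_square)
  have "1 + bump b n x \<noteq> 0" for x using pos[of x] by simp
  moreover have "continuous_on UNIV (bump b n)"
    unfolding bump_def[abs_def] by (intro continuous_intros)
  moreover have "continuous_on UNIV (bump' b n)"
    unfolding bump'_def[abs_def] by (intro continuous_intros)
  ultimately show "continuous_on UNIV (\<lambda>x. bump' b n x / (1 + bump b n x)\<^sup>2)"
    by (intro continuous_intros) auto
  have n: "1 / real n > 0" using assms(2) by simp
  show "\<exists>K. compact K \<and> K \<subseteq> {0<..<1} \<and> (\<forall>x. x \<notin> K \<longrightarrow> bump b n x / (1 + bump b n x) = 0)"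
  proof (intro exI[of _ "{1 / real n..b - 1 / real n}"] conjI allI impI)
    show "{1 / real n..b - 1 / real n} \<subseteq> {0<..<1}"
    proof
      fix x assume "x \<in> {1 / real n..b - 1 / real n}"
      then show "x \<in> {0<..<1}" using n assms(1) unfolding atLeastAtMost_iff greaterThanLessThan_iff by linarith
    qed
    fix x assume "x \<notin> {1 / real n..b - 1 / real n}"
    then show "bump b n x / (1 + bump b n x) = 0"
      by (auto simp: bump_def not_le max_absorb1)
  qed simp
qed

lemma bump_tendsto:
  "(\<lambda>n. bump b (Suc n) x / (1 + bump b (Suc n) x)) \<longlonglongrightarrow> (if 0 < x \<and> x < b then 1 else 0)"
proof (cases "0 < x \<and> x < b")
  case False
  have "bump b (Suc n) x = 0" for n
  proof -
    have "max 0 (x - 1 / real (Suc n)) = 0 \<or> max 0 (b - 1 / real (Suc n) - x) = 0"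
      using False by (smt (verit) divide_nonneg_nonneg of_nat_0_le_iff)
    then show ?thesis by (auto simp: bump_def)
  qed
  then show ?thesis using False by (subst if_not_P) auto
next
  case True
  have n: "(\<lambda>n. 1 / real (Suc n)) \<longlonglongrightarrow> 0"
    using LIMSEQ_inverse_real_of_nat by (simp add: inverse_eq_divide)
  have lim: "(\<lambda>n. (max 0 (x - 1 / real (Suc n)))\<^sup>2 * (max 0 (b - 1 / real (Suc n) - x))\<^sup>2)
      \<longlonglongrightarrow> (max 0 (x - 0))\<^sup>2 * (max 0 (b - 0 - x))\<^sup>2"
    by (intro tendsto_intros n)
  have "filterlim (\<lambda>n. real (Suc n)) at_top sequentially"
    by (rule filterlim_compose[OF filterlim_real_sequentially filterlim_Suc])
  from filterlim_tendsto_pos_mult_at_top[OF lim _ this]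
  have "filterlim (\<lambda>n. ((max 0 (x - 1 / real (Suc n)))\<^sup>2 * (max 0 (b - 1 / real (Suc n) - x))\<^sup>2) *
      real (Suc n)) at_top sequentially"
    using True by simp
  then have "filterlim (\<lambda>n. bump b (Suc n) x) at_top sequentially"
    by (simp add: bump_def mult.commute)
  then have "filterlim (\<lambda>n. 1 + bump b (Suc n) x) at_top sequentially"
    by (rule filterlim_tendsto_add_at_top[OF tendsto_const])
  then have "(\<lambda>n. inverse (1 + bump b (Suc n) x)) \<longlonglongrightarrow> 0"
    by (rule tendsto_inverse_0_at_top)
  from tendsto_diff[OF tendsto_const[of 1] this]
  have "(\<lambda>n. 1 - inverse (1 + bump b (Suc n) x)) \<longlonglongrightarrow> 1" by simp
  moreover have "1 - inverse (1 + bump b n x) = bump b n x / (1 + bump b n x)" for n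
    using bump_nonneg[of b n x] by (simp add: field_simps)
  ultimately show ?thesis using True by simp
qed

lemma orthogonal_to_test_functions:
  assumes w: "\<And>\<phi> \<phi>'. test_pair \<phi> \<phi>' \<Longrightarrow> (LINT x|unit_leb. rep_L2 w x * \<phi> x) = 0"
  shows "w = 0"
proof -
  define f where "f = rep_L2 w"
  have f: "sq_integrable f" and wf: "w = abs_L2 f" by (simp_all add: f_def sq_integrable_rep)
  have [measurable]: "f \<in> borel_measurable unit_leb" using f by (simp add: sq_integrable_def)
  have fi: "integrable unit_leb f"
    using f unfolding sq_integrable_def
    by (elim conjE) (rule finite_measure.square_integrable_imp_integrable[OF finite_measure_unit_leb])
  have ind: "w \<bullet> abs_L2 (indicat_real {..<c}) = 0" for c
  proof -
    define b where "b = min c 1"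
    define \<phi> where "\<phi> n x = bump b (Suc n) x / (1 + bump b (Suc n) x)" for n x
    have tp: "test_pair (\<phi> n) (\<lambda>x. bump' b (Suc n) x / (1 + bump b (Suc n) x)\<^sup>2)" for n
      unfolding \<phi>_def by (rule test_pair_bump) (auto simp: b_def)
    have cont: "continuous_on UNIV (\<phi> n)" for n
      using tp[of n] unfolding test_pair_def
      by (auto intro!: continuous_at_imp_continuous_on DERIV_isCont)
    have [measurable]: "\<phi> n \<in> borel_measurable unit_leb" for n
      using borel_measurable_continuous_onI[OF cont[of n]]
      by (intro measurable_restrict_space1 measurable_completion) simp
    have [measurable]: "indicat_real {..<c} \<in> borel_measurable unit_leb"
      using sq_integrable_indicator[of "{..<c}"] by (simp add: sq_integrable_def)
    have "(\<lambda>n. LINT x|unit_leb. f x * \<phi> n x) \<longlonglongrightarrow> (LINT x|unit_leb. f x * indicat_real {..<c} x)"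
    proof (rule integral_dominated_convergence[where w = "\<lambda>x. \<bar>f x\<bar>"])
      show "integrable unit_leb (\<lambda>x. \<bar>f x\<bar>)" using fi by simp
      show "AE x in unit_leb. (\<lambda>n. f x * \<phi> n x) \<longlonglongrightarrow> f x * indicat_real {..<c} x"
      proof (rule AE_I2)
        fix x assume "x \<in> space unit_leb"
        then have "indicat_real {..<c} x = (if 0 < x \<and> x < b then 1 else 0)"
          by (auto simp: b_def indicator_def)
        then show "(\<lambda>n. f x * \<phi> n x) \<longlonglongrightarrow> f x * indicat_real {..<c} x"
          unfolding \<phi>_def by (intro tendsto_intros) (simp only: bump_tendsto)
      qed
      show "AE x in unit_leb. norm (f x * \<phi> n x) \<le> \<bar>f x\<bar>" for n
      proof (rule AE_I2)
        fix x
        have "0 \<le> \<phi> n x" "\<phi> n x \<le> 1"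
          using bump_nonneg[of b "Suc n" x] by (auto simp: \<phi>_def divide_simps)
        then show "norm (f x * \<phi> n x) \<le> \<bar>f x\<bar>"
          by (simp add: abs_mult mult_left_le)
      qed
    qed simp_all
    moreover have "(LINT x|unit_leb. f x * \<phi> n x) = 0" for n
      using w[OF tp[of n]] by (simp add: f_def)
    ultimately have "(LINT x|unit_leb. f x * indicat_real {..<c} x) = 0"
      using LIMSEQ_unique[OF _ tendsto_const] by auto
    then show ?thesis unfolding wf by (subst inner_abs_L2) (auto intro: f sq_integrable_indicator)
  qed
  have step: "w \<bullet> abs_L2 (step_fun xs) = 0" for xs
  proof (induction xs)
    case Nil
    then show ?case by (simp add: step_fun_def[abs_def] abs_L2_zero)
  next
    case (Cons p xs)
    obtain a c where p: "p = (a, c)" by fastforce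
    define k :: "real \<Rightarrow> real" where "k = indicat_real {..<of_rat a}"
    have k: "sq_integrable k" unfolding k_def by (rule sq_integrable_indicator) simp
    have "step_fun (p # xs) = (\<lambda>t. of_rat c * k t + step_fun xs t)"
      by (simp add: step_fun_def[abs_def] p k_def)
    then have "abs_L2 (step_fun (p # xs)) = of_rat c *\<^sub>R abs_L2 k + abs_L2 (step_fun xs)"
      by (simp add: abs_L2_scale[OF k] abs_L2_add[OF sq_integrable_scale[OF k] sq_integrable_step_fun])
    then show ?case using Cons ind by (simp add: inner_add_right k_def)
  qed
  have "closed {v. w \<bullet> v = 0}" by (rule closed_hyperplane)
  moreover have "range (\<lambda>xs. abs_L2 (step_fun xs)) \<subseteq> {v. w \<bullet> v = 0}" using step by auto
  ultimately have "step_cl \<subseteq> {v. w \<bullet> v = 0}" unfolding step_cl_def by (rule closure_minimal[rotated])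
  then have "w \<bullet> w = 0" using step_cl_eq_UNIV by blast
  then show ?thesis by simp
qed

lemma test_function_integrable:
  assumes "test_pair \<phi> \<phi>'" "sq_integrable f"
  shows "integrable unit_leb (\<lambda>x. f x * \<phi> x)"
proof (rule sq_integrable_mult[OF assms(2)])
  have cont: "continuous_on UNIV \<phi>"
    using assms(1) unfolding test_pair_def
    by (auto intro!: continuous_at_imp_continuous_on DERIV_isCont)
  have m: "\<phi> \<in> borel_measurable unit_leb"
    using borel_measurable_continuous_onI[OF cont]
    by (intro measurable_restrict_space1 measurable_completion) simp
  obtain K where K: "compact K" "\<And>x. x \<notin> K \<Longrightarrow> \<phi> x = 0"
    using assms(1) unfolding test_pair_def by blast
  have "compact (\<phi> ` K)" using cont K(1) by (meson compact_continuous_image continuous_on_subset subset_UNIV)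
  then obtain B where B: "B > 0" "\<And>y. y \<in> \<phi> ` K \<Longrightarrow> norm y \<le> B"
    using compact_imp_bounded bounded_pos by metis
  have "\<bar>\<phi> x\<bar> \<le> B" for x
    using B K(2)[of x] by (cases "x \<in> K") auto
  then show "sq_integrable \<phi>" by (rule sq_integrable_bounded[OF m])
qed

lemma weak_deriv_unique:
  assumes "weak_deriv u v" "weak_deriv u w"
  shows "v = w"
proof -
  have "(LINT x|unit_leb. rep_L2 (v - w) x * \<phi> x) = 0" if t: "test_pair \<phi> \<phi>'" for \<phi> \<phi>'
  proof -
    have d: "AE x in unit_leb. rep_L2 (v - w) x = rep_L2 v x - rep_L2 w x"
      using rep_abs_L2[OF sq_integrable_diff[OF sq_integrable_rep[of v] sq_integrable_rep[of w]]]
      by (simp add: abs_L2_diff[symmetric] sq_integrable_rep)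
    have i: "integrable unit_leb (\<lambda>x. rep_L2 v x * \<phi> x)" "integrable unit_leb (\<lambda>x. rep_L2 w x * \<phi> x)"
      "integrable unit_leb (\<lambda>x. rep_L2 (v - w) x * \<phi> x)"
      by (auto intro!: test_function_integrable[OF t] sq_integrable_rep)
    have "(LINT x|unit_leb. rep_L2 (v - w) x * \<phi> x) =
        (LINT x|unit_leb. rep_L2 v x * \<phi> x - rep_L2 w x * \<phi> x)"
    proof (rule integral_cong_AE)
      show "AE x in unit_leb. rep_L2 (v - w) x * \<phi> x = rep_L2 v x * \<phi> x - rep_L2 w x * \<phi> x"
        using d by eventually_elim (simp add: left_diff_distrib)
    qed (use i in auto)
    also have "\<dots> = (LINT x|unit_leb. rep_L2 v x * \<phi> x) - (LINT x|unit_leb. rep_L2 w x * \<phi> x)"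
      using i by simp
    also have "\<dots> = 0"
      using assms t unfolding weak_deriv_iff by force
    finally show ?thesis .
  qed
  then have "v - w = 0" by (rule orthogonal_to_test_functions)
  then show ?thesis by simp
qed

lemma weak_deriv_C1:
  assumes g: "\<And>x. (g has_real_derivative g' x) (at x)" and g': "continuous_on UNIV g'"
    and sq: "sq_integrable g" "sq_integrable g'"
  shows "weak_deriv (abs_L2 g) (abs_L2 g')"
  unfolding weak_deriv_iff
proof (intro allI impI)
  fix \<phi> \<phi>' assume t: "test_pair \<phi> \<phi>'"
  have d\<phi>: "\<And>x. (\<phi> has_real_derivative \<phi>' x) (at x)" and c\<phi>': "continuous_on UNIV \<phi>'"
    using t by (auto simp: test_pair_def)
  have c\<phi>: "continuous_on UNIV \<phi>" and cg: "continuous_on UNIV g"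
    using d\<phi> g by (auto intro!: continuous_at_imp_continuous_on DERIV_isCont)
  have bdry: "\<phi> 0 = 0" "\<phi> 1 = 0" using t by (auto simp: test_pair_def)
  have b: "sq_integrable h" if "continuous_on UNIV h" for h :: "real \<Rightarrow> real"
  proof -
    have m: "h \<in> borel_measurable unit_leb"
      using borel_measurable_continuous_onI[OF that]
      by (intro measurable_restrict_space1 measurable_completion) simp
    have "compact (h ` {0..1})" using that by (meson compact_Icc compact_continuous_image continuous_on_subset subset_UNIV)
    then obtain B where B: "\<And>y. y \<in> h ` {0..1} \<Longrightarrow> norm y \<le> B"
      using compact_imp_bounded bounded_pos by metis
    have "integrable unit_leb (\<lambda>x. (h x)\<^sup>2)"
    proof (rule finite_measure.integrable_const_bound[OF finite_measure_unit_leb, of _ "B\<^sup>2"])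
      show "AE x in unit_leb. norm ((h x)\<^sup>2) \<le> B\<^sup>2"
      proof (rule AE_I2)
        fix x assume "x \<in> space unit_leb"
        then have "\<bar>h x\<bar> \<le> B" using B[of "h x"] by auto
        from power_mono[OF this, of 2] show "norm ((h x)\<^sup>2) \<le> B\<^sup>2" by simp
      qed
    qed (use m in simp)
    then show ?thesis using m by (simp add: sq_integrable_def)
  qed
  have i1: "integrable unit_leb (\<lambda>x. g x * \<phi>' x)" and i2: "integrable unit_leb (\<lambda>x. g' x * \<phi> x)"
    by (intro sq_integrable_mult b cg c\<phi>' g' c\<phi>)+
  define k where "k x = g x * \<phi>' x + g' x * \<phi> x" for x
  have ck: "continuous_on UNIV k" unfolding k_def by (intro continuous_intros cg c\<phi>' g' c\<phi>)
  have km[measurable]: "k \<in> borel_measurable borel" using ck by (rule borel_measurable_continuous_onI)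
  have "(LINT x|lborel. k x * indicat_real {0..1} x) = g 1 * \<phi> 1 - g 0 * \<phi> 0"
  proof (rule integral_FTC_Icc_real)
    show "((\<lambda>x. g x * \<phi> x) has_real_derivative k x) (at x)" for x
      unfolding k_def by (rule DERIV_cong[OF DERIV_mult[OF g d\<phi>]]) (simp add: algebra_simps)
    show "isCont k x" for x using ck by (simp add: continuous_on_eq_continuous_at)
  qed simp
  then have "(LINT x|lborel. k x * indicat_real {0..1} x) = 0" by (simp add: bdry)
  moreover have "(LINT x|unit_leb. k x) = (LINT x|lebesgue. indicat_real {0<..<1} x *\<^sub>R k x)"
    by (subst integral_restrict_space) auto
  moreover have "\<dots> = (LINT x|lborel. indicat_real {0<..<1} x *\<^sub>R k x)"
    by (rule integral_completion) simp
  moreover have "\<dots> = (LINT x|lborel. k x * indicat_real {0..1} x)"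
  proof (rule integral_cong_AE)
    have "AE x in lborel. x \<noteq> (0::real)" "AE x in lborel. x \<noteq> (1::real)"
      by (rule AE_lborel_singleton)+
    then show "AE x in lborel. indicat_real {0<..<1} x *\<^sub>R k x = k x * indicat_real {0..1} x"
      by eventually_elim (auto simp: indicator_def)
  qed simp_all
  ultimately have "(LINT x|unit_leb. k x) = 0" by simp
  then have eq: "(LINT x|unit_leb. g x * \<phi>' x) = - (LINT x|unit_leb. g' x * \<phi> x)"
    using i1 i2 by (simp add: k_def)
  have m: "\<phi> \<in> borel_measurable unit_leb" "\<phi>' \<in> borel_measurable unit_leb"
    using b[OF c\<phi>] b[OF c\<phi>'] by (auto simp: sq_integrable_def)
  have rm: "rep_L2 (abs_L2 h) \<in> borel_measurable unit_leb" for h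
    using sq_integrable_rep[of "abs_L2 h"] by (simp add: sq_integrable_def)
  have r: "(LINT x|unit_leb. rep_L2 (abs_L2 h) x * \<psi> x) = (LINT x|unit_leb. h x * \<psi> x)"
    if "sq_integrable h" "\<psi> \<in> borel_measurable unit_leb" for h \<psi>
  proof (rule integral_cong_AE)
    show "AE x in unit_leb. rep_L2 (abs_L2 h) x * \<psi> x = h x * \<psi> x"
      using rep_abs_L2[OF that(1)] by eventually_elim simp
  qed (use that rm[of h] in \<open>auto simp: sq_integrable_def\<close>)
  show "(LINT x|unit_leb. rep_L2 (abs_L2 g) x * \<phi>' x) = - (LINT x|unit_leb. rep_L2 (abs_L2 g') x * \<phi> x)"
    using eq by (simp add: r sq m)
qed

lemma sq_integrable_sin: "sq_integrable (\<lambda>x. c * sin (a * x))"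
  and sq_integrable_cos: "sq_integrable (\<lambda>x. c * cos (a * x))"
proof -
  have "(\<lambda>x. sin (a * x)) \<in> borel_measurable unit_leb" "(\<lambda>x. cos (a * x)) \<in> borel_measurable unit_leb"
    by (intro measurable_restrict_space1 measurable_completion; simp)+
  then show "sq_integrable (\<lambda>x. c * sin (a * x))" "sq_integrable (\<lambda>x. c * cos (a * x))"
    by (auto intro!: sq_integrable_scale sq_integrable_bounded[of _ 1])
qed

lemma e_basis_rep_sq_integrable: "sq_integrable (\<lambda>x. sqrt 2 * sin (real i * pi * x))"
  by (rule sq_integrable_sin)

lemma weak_deriv_e_basis:
  defines "v i \<equiv> abs_L2 (\<lambda>x. sqrt 2 * (real i * pi) * cos (real i * pi * x))"
  shows "weak_deriv (e_basis i) (v i)" "weak_deriv (v i) (- eigval i *\<^sub>R e_basis i)"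
proof -
  show "weak_deriv (e_basis i) (v i)"
    unfolding e_basis_def v_def
    by (rule weak_deriv_C1)
      (auto intro!: derivative_eq_intros continuous_intros sq_integrable_sin sq_integrable_cos)
  have "- eigval i *\<^sub>R e_basis i = abs_L2 (\<lambda>x. - eigval i * (sqrt 2 * sin (real i * pi * x)))"
    unfolding e_basis_def by (rule abs_L2_scale[OF sq_integrable_sin])
  also have "(\<lambda>x. - eigval i * (sqrt 2 * sin (real i * pi * x))) =
      (\<lambda>x. (- eigval i * sqrt 2) * sin (real i * pi * x))" by (simp add: mult.assoc)
  finally have e: "- eigval i *\<^sub>R e_basis i = abs_L2 (\<lambda>x. (- eigval i * sqrt 2) * sin (real i * pi * x))" .
  show "weak_deriv (v i) (- eigval i *\<^sub>R e_basis i)"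
    unfolding e v_def
  proof (rule weak_deriv_C1)
    show "((\<lambda>x. sqrt 2 * (real i * pi) * cos (real i * pi * x)) has_real_derivative
        (- eigval i * sqrt 2) * sin (real i * pi * x)) (at x)" for x
      by (auto intro!: derivative_eq_intros simp: eigval_def power2_eq_square)
  qed (rule sq_integrable_sin sq_integrable_cos | intro continuous_intros)+
qed

lemma lap_e_basis: "e_basis i \<in> lap_dom" "lap (e_basis i) = - eigval i *\<^sub>R e_basis i"
proof -
  have "AE x in unit_leb. rep_L2 (e_basis i) x = sqrt 2 * sin (real i * pi * x)"
    unfolding e_basis_def by (rule rep_abs_L2[OF sq_integrable_sin])
  then have "e_basis i \<in> sobolev_H10"
    unfolding sobolev_H10_def sobolev_H1_def using weak_deriv_e_basis[of i]
    by (auto intro!: exI[of _ "\<lambda>x. sqrt 2 * sin (real i * pi * x)"] continuous_intros)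
  then show "e_basis i \<in> lap_dom"
    unfolding lap_dom_def sobolev_H2_def using weak_deriv_e_basis[of i] by auto
  show "lap (e_basis i) = - eigval i *\<^sub>R e_basis i"
    unfolding lap_def
    using weak_deriv_e_basis[of i] by (intro the_equality) (auto dest: weak_deriv_unique)
qed

text \<open>The functional calculus $g(-A)$ of the positive self-adjoint operator $-A$ and its domain.\<close>

definition spectral :: "(real \<Rightarrow> real) \<Rightarrow> L2 \<Rightarrow> L2" where
  "spectral g u = (\<Sum>i. (g (eigval (Suc i)) * (u \<bullet> e_basis (Suc i))) *\<^sub>R e_basis (Suc i))"

definition spectral_dom :: "(real \<Rightarrow> real) \<Rightarrow> L2 set" where
  "spectral_dom g = {u. summable (\<lambda>i. (g (eigval (Suc i)) * (u \<bullet> e_basis (Suc i)))\<^sup>2)}"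

definition frac_pow :: "real \<Rightarrow> L2 \<Rightarrow> L2" where
  "frac_pow s = spectral (\<lambda>l. l powr s)"

definition frac_dom :: "real \<Rightarrow> L2 set" where
  "frac_dom s = spectral_dom (\<lambda>l. l powr s)"

definition Hdot :: "real \<Rightarrow> L2 set" where
  "Hdot \<gamma> = frac_dom (\<gamma> / 2)"

definition Hdot_norm :: "real \<Rightarrow> L2 \<Rightarrow> real" where
  "Hdot_norm \<gamma> u = norm (frac_pow (\<gamma> / 2) u)"

definition heat_semigroup :: "real \<Rightarrow> L2 \<Rightarrow> L2" where
  "heat_semigroup t = spectral (\<lambda>l. exp (- l * t))"


section \<open>Operators on $H$\<close>

definition self_adjoint :: "(L2 \<Rightarrow> L2) \<Rightarrow> bool" where
  "self_adjoint T \<longleftrightarrow> (\<forall>u v. T u \<bullet> v = u \<bullet> T v)"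

definition positive_definite :: "(L2 \<Rightarrow> L2) \<Rightarrow> bool" where
  "positive_definite T \<longleftrightarrow> (\<forall>u. u \<noteq> 0 \<longrightarrow> 0 < T u \<bullet> u)"

text \<open>The unique bounded, self-adjoint, positive semidefinite square root.\<close>

definition op_sqrt :: "(L2 \<Rightarrow> L2) \<Rightarrow> L2 \<Rightarrow> L2" where
  "op_sqrt Q = (THE R. bounded_linear R \<and> self_adjoint R \<and> (\<forall>u. 0 \<le> R u \<bullet> u) \<and> R \<circ> R = Q)"

text \<open>
  $Q^{-1/2}$ on $\mathcal{D}(Q^{-1/2}) = Q^{1/2}(H)$; outside that set its values are irrelevant.
\<close>

definition op_inv_sqrt :: "(L2 \<Rightarrow> L2) \<Rightarrow> L2 \<Rightarrow> L2" where
  "op_inv_sqrt Q = inv (op_sqrt Q)"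

definition op_inv_sqrt_dom :: "(L2 \<Rightarrow> L2) \<Rightarrow> L2 set" where
  "op_inv_sqrt_dom Q = range (op_sqrt Q)"

definition hilbert_schmidt :: "(L2 \<Rightarrow> L2) \<Rightarrow> bool" where
  "hilbert_schmidt T \<longleftrightarrow> bounded_linear T \<and> summable (\<lambda>i. (norm (T (e_basis (Suc i))))\<^sup>2)"


section \<open>Rate function of the invariant measures of the SPDE\<close>

text \<open>
  Elements of $L^2(0,T;H)$ are represented by Borel functions; only the values on $[0,T]$ matter.
\<close>

definition L2_path :: "real \<Rightarrow> (real \<Rightarrow> L2) \<Rightarrow> bool" where
  "L2_path T \<phi> \<longleftrightarrow> set_borel_measurable lborel {0..T} \<phi> \<and>
     set_integrable lborel {0..T} (\<lambda>s. (norm (\<phi> s))\<^sup>2)"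

definition energy :: "real \<Rightarrow> (real \<Rightarrow> L2) \<Rightarrow> real" where
  "energy T \<phi> = (LINT s:{0..T}|lborel. (norm (\<phi> s))\<^sup>2)"

definition mild_solution ::
  "(L2 \<Rightarrow> L2) \<Rightarrow> (L2 \<Rightarrow> L2) \<Rightarrow> real \<Rightarrow> L2 \<Rightarrow> (real \<Rightarrow> L2) \<Rightarrow> (real \<Rightarrow> L2) \<Rightarrow> bool" where
  "mild_solution F Q T x \<phi> z \<longleftrightarrow> (\<forall>t\<in>{0..T}.
     set_integrable lborel {0..t} (\<lambda>s. heat_semigroup (t - s) (F (z s) + op_sqrt Q (\<phi> s))) \<and>
     z t = heat_semigroup t x +
       (LINT s:{0..t}|lborel. heat_semigroup (t - s) (F (z s) + op_sqrt Q (\<phi> s))))"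

definition path_rate :: "(L2 \<Rightarrow> L2) \<Rightarrow> (L2 \<Rightarrow> L2) \<Rightarrow> real \<Rightarrow> L2 \<Rightarrow> (real \<Rightarrow> L2) \<Rightarrow> ereal" where
  "path_rate F Q T x z =
     ereal (1 / 2) * Inf {ereal (energy T \<phi>) |\<phi>. L2_path T \<phi> \<and> mild_solution F Q T x \<phi> z}"

definition rate_V :: "(L2 \<Rightarrow> L2) \<Rightarrow> (L2 \<Rightarrow> L2) \<Rightarrow> L2 \<Rightarrow> ereal" where
  "rate_V F Q u =
     Inf {path_rate F Q T 0 z |T z. T > 0 \<and> continuous_on {0..T} z \<and> z 0 = 0 \<and> z T = u}"


section \<open>Rate function of the fully discrete method\<close>

definition H_fin :: "nat \<Rightarrow> L2 set" where
  "H_fin n = span (e_basis ` {1..n})"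

text \<open>Orthogonal projection onto \<^const>\<open>H_fin\<close>.\<close>

definition proj :: "nat \<Rightarrow> L2 \<Rightarrow> L2" where
  "proj n u = (THE p. p \<in> H_fin n \<and> (\<forall>v\<in>H_fin n. (u - p) \<bullet> v = 0))"

definition lap_fin :: "nat \<Rightarrow> L2 \<Rightarrow> L2" where
  "lap_fin n u = proj n (lap u)"

text \<open>$e^{tA_n}$ on the finite-dimensional space $H_n$, as the exponential series of $A_n$.\<close>

definition semigroup_fin :: "nat \<Rightarrow> real \<Rightarrow> L2 \<Rightarrow> L2" where
  "semigroup_fin n t u = (\<Sum>k. (t ^ k / fact k) *\<^sub>R (lap_fin n ^^ k) u)"

definition mild_solution_fin ::
  "(L2 \<Rightarrow> L2) \<Rightarrow> (L2 \<Rightarrow> L2) \<Rightarrow> nat \<Rightarrow> real \<Rightarrow> real \<Rightarrow> L2 \<Rightarrow> (real \<Rightarrow> L2) \<Rightarrow> (real \<Rightarrow> L2) \<Rightarrow> bool" where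
  "mild_solution_fin F Q n \<tau> T y \<phi> z \<longleftrightarrow> (\<forall>t\<in>{0..T}.
     set_integrable lborel {0..t} (\<lambda>s. semigroup_fin n (t - s)
       (proj n (F (z (\<tau> * of_int \<lfloor>s / \<tau>\<rfloor>))) + proj n (op_sqrt Q (\<phi> s)))) \<and>
     z t = semigroup_fin n t y + (LINT s:{0..t}|lborel. semigroup_fin n (t - s)
       (proj n (F (z (\<tau> * of_int \<lfloor>s / \<tau>\<rfloor>))) + proj n (op_sqrt Q (\<phi> s)))))"

definition path_rate_fin ::
  "(L2 \<Rightarrow> L2) \<Rightarrow> (L2 \<Rightarrow> L2) \<Rightarrow> nat \<Rightarrow> real \<Rightarrow> real \<Rightarrow> L2 \<Rightarrow> (real \<Rightarrow> L2) \<Rightarrow> ereal" where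
  "path_rate_fin F Q n \<tau> T y z =
     ereal (1 / 2) * Inf {ereal (energy T \<phi>) |\<phi>. L2_path T \<phi> \<and> (\<forall>s\<in>{0..T}. \<phi> s \<in> H_fin n) \<and>
       mild_solution_fin F Q n \<tau> T y \<phi> z}"

definition rate_V_fin ::
  "(L2 \<Rightarrow> L2) \<Rightarrow> (L2 \<Rightarrow> L2) \<Rightarrow> nat \<Rightarrow> real \<Rightarrow> L2 \<Rightarrow> ereal" where
  "rate_V_fin F Q n \<tau> u =
     Inf {path_rate_fin F Q n \<tau> T 0 z |T z. T > 0 \<and> continuous_on {0..T} z \<and>
       (\<forall>t\<in>{0..T}. z t \<in> H_fin n) \<and> z 0 = 0 \<and> z T = u}"

end

theory Submission
  imports Defs
begin

text \<open>
  For \<open>F = 0\<close> both control problems decouple into the modes \<open>e\<^sub>i\<close>. Completing the square in each mode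
  shows that steering from 0 to \<open>u\<close> costs at least \<open>W\<^sub>n u = (\<Sum>i\<le>n. \<lambda>\<^sub>i u\<^sub>i^2 / q\<^sub>i)\<close> for every \<open>n\<close>, and on
  \<open>H\<^sub>n\<close> the optimal controls on \<open>[0, T]\<close> attain \<open>W\<^sub>n\<close> as \<open>T\<close> tends to infinity, so \<open>W\<^sub>n\<close> is the discrete
  rate function. No matching upper bound for \<open>V\<close> is required: the gap \<open>V u - W\<^sub>n u\<close> is filled
  exactly by adding \<open>\<delta> e\<^sub>N\<close> to the projection of \<open>u\<close>, with \<open>\<delta>^2 = (V u - W\<^sub>n u) q\<^sub>N / \<lambda>\<^sub>N\<close>, and
  \<open>\<delta>\<close> is small for large \<open>N\<close>.
\<close>

section \<open>Completeness of the sine basis\<close>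

lemma borel_measurable_unit_leb_continuous:
  assumes "continuous_on UNIV (h :: real \<Rightarrow> real)"
  shows "h \<in> borel_measurable unit_leb"
  using borel_measurable_continuous_onI[OF assms]
  by (intro measurable_restrict_space1 measurable_completion) simp

lemma sq_integrable_continuous:
  assumes h: "continuous_on UNIV h"
  shows "sq_integrable h"
proof -
  have m[measurable]: "h \<in> borel_measurable unit_leb"
    by (rule borel_measurable_unit_leb_continuous[OF h])
  have "compact (h ` {0..1})"
    using h by (meson compact_Icc compact_continuous_image continuous_on_subset subset_UNIV)
  then obtain B where B: "\<And>y. y \<in> h ` {0..1} \<Longrightarrow> norm y \<le> B"
    using compact_imp_bounded bounded_pos by metis
  have "integrable unit_leb (\<lambda>x. (h x)\<^sup>2)"
  proof (rule finite_measure.integrable_const_bound[OF finite_measure_unit_leb, of _ "B\<^sup>2"])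
    show "AE x in unit_leb. norm ((h x)\<^sup>2) \<le> B\<^sup>2"
    proof (rule AE_I2)
      fix x assume "x \<in> space unit_leb"
      then have "\<bar>h x\<bar> \<le> B" using B[of "h x"] by auto
      from power_mono[OF this, of 2] show "norm ((h x)\<^sup>2) \<le> B\<^sup>2" by simp
    qed
  qed simp
  then show ?thesis by (simp add: sq_integrable_def)
qed

text \<open>The two end points form a null set, so the open interval under completed Lebesgue
  measure may be exchanged for the closed interval under Borel measure, where the fundamental
  theorem of calculus applies.\<close>

lemma integral_unit_leb_FTC:
  assumes G: "\<And>x. (G has_real_derivative g x) (at x)" and g: "continuous_on UNIV g"
  shows "(LINT x|unit_leb. g x) = G 1 - G 0"
proof -
  have [measurable]: "g \<in> borel_measurable borel"
    using g by (rule borel_measurable_continuous_onI)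
  have "(LINT x|unit_leb. g x) = (LINT x|lebesgue. indicat_real {0<..<1} x *\<^sub>R g x)"
    by (subst integral_restrict_space) auto
  also have "\<dots> = (LINT x|lborel. indicat_real {0<..<1} x *\<^sub>R g x)"
    by (rule integral_completion) simp
  also have "\<dots> = (LINT x|lborel. g x * indicat_real {0..1} x)"
  proof (rule integral_cong_AE)
    have "AE x in lborel. x \<noteq> (0::real)" "AE x in lborel. x \<noteq> (1::real)"
      by (rule AE_lborel_singleton)+
    then show "AE x in lborel. indicat_real {0<..<1} x *\<^sub>R g x = g x * indicat_real {0..1} x"
      by eventually_elim (auto simp: indicator_def)
  qed simp_all
  also have "\<dots> = G 1 - G 0"
    by (rule integral_FTC_Icc_real)
      (use G g in \<open>auto simp: continuous_on_eq_continuous_at\<close>)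
  finally show ?thesis .
qed

section \<open>Orthonormality and completeness of the sines\<close>

lemma integral_cos_unit_leb:
  "(LINT x|unit_leb. cos (real_of_int m * pi * x)) = (if m = 0 then 1 else 0)"
proof (cases "m = 0")
  case True
  then show ?thesis using integral_unit_leb_FTC[of "\<lambda>x. x" "\<lambda>x. 1"] by simp
next
  case False
  have "(LINT x|unit_leb. cos (real_of_int m * pi * x)) =
      sin (real_of_int m * pi * 1) / (real_of_int m * pi) - sin (real_of_int m * pi * 0) / (real_of_int m * pi)"
    using False
    by (intro integral_unit_leb_FTC) (auto intro!: derivative_eq_intros continuous_intros)
  then show ?thesis using False by (simp add: sin_times_pi_eq_0)
qed

text \<open>The product formula leaves cosines of frequencies \<open>i - j\<close> and
  \<open>i + j\<close>, taken as integers so that the difference is not truncated. Only frequency 0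
  survives integration, and \<open>i + j\<close> is never 0 because the indices start at 1.\<close>

lemma inner_e_basis:
  assumes "i \<ge> 1" "j \<ge> 1"
  shows "e_basis i \<bullet> e_basis j = (if i = j then 1 else 0)"
proof -
  let ?c = "\<lambda>m x. cos (real_of_int m * pi * x)"
  have "e_basis i \<bullet> e_basis j =
      (LINT x|unit_leb. (sqrt 2 * sin (real i * pi * x)) * (sqrt 2 * sin (real j * pi * x)))"
    unfolding e_basis_def by (intro inner_abs_L2 sq_integrable_sin)
  also have "\<dots> = (LINT x|unit_leb. ?c (int i - int j) x - ?c (int i + int j) x)"
  proof (rule Bochner_Integration.integral_cong[OF refl])
    fix x
    have "(sqrt 2 * sin (real i * pi * x)) * (sqrt 2 * sin (real j * pi * x)) =
        (sqrt 2 * sqrt 2) * (sin (real i * pi * x) * sin (real j * pi * x))" by algebra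
    also have "\<dots> = cos (real i * pi * x - real j * pi * x) - cos (real i * pi * x + real j * pi * x)"
      by (simp add: sin_times_sin)
    finally show "(sqrt 2 * sin (real i * pi * x)) * (sqrt 2 * sin (real j * pi * x)) =
        ?c (int i - int j) x - ?c (int i + int j) x"
      by (simp add: algebra_simps)
  qed
  also have "\<dots> = (LINT x|unit_leb. ?c (int i - int j) x) - (LINT x|unit_leb. ?c (int i + int j) x)"
    using sq_integrable_mult[OF sq_integrable_cos[of 1] sq_integrable_continuous[of "\<lambda>x. 1"]]
    by (intro Bochner_Integration.integral_diff) auto
  also have "\<dots> = (if i = j then 1 else 0)"
    unfolding integral_cos_unit_leb using assms by auto
  finally show ?thesis .
qed

text \<open>Orthogonality to all sines extends to all products
  \<open>sin (pi * x) * p (cos (pi * x))\<close> with a polynomial \<open>p\<close>. By Weierstrass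
  approximation in the variable \<open>cos (pi * x)\<close> these products approximate every test
  function uniformly on the interval, so \<open>w\<close> is orthogonal to all test
  functions.\<close>

lemma orthogonal_e_basis_imp_eq_0:
  assumes w: "\<And>i. i \<ge> 1 \<Longrightarrow> w \<bullet> e_basis i = 0"
  shows "w = 0"
proof (rule orthogonal_to_test_functions)
  define f where "f = rep_L2 w"
  have f: "sq_integrable f" and wf: "w = abs_L2 f" by (simp_all add: f_def sq_integrable_rep)
  have fi: "integrable unit_leb f"
    using f unfolding sq_integrable_def
    by (elim conjE) (rule finite_measure.square_integrable_imp_integrable[OF finite_measure_unit_leb])
  have int: "integrable unit_leb (\<lambda>x. f x * h x)" if "continuous_on UNIV h" for h
    by (rule sq_integrable_mult[OF f sq_integrable_continuous[OF that]])
  have sin0: "(LINT x|unit_leb. f x * sin (real i * pi * x)) = 0" for i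
  proof (cases "i = 0")
    case False
    have "w \<bullet> e_basis i = (LINT x|unit_leb. f x * (sqrt 2 * sin (real i * pi * x)))"
      unfolding wf e_basis_def by (rule inner_abs_L2[OF f sq_integrable_sin])
    also have "\<dots> = sqrt 2 * (LINT x|unit_leb. f x * sin (real i * pi * x))"
      by (simp only: mult.left_commute[of _ "sqrt 2"] integral_mult_right_zero)
    finally show ?thesis using w[of i] False by simp
  qed simp
  \<comment> \<open>Multiplying \<open>sin (real i * pi * x)\<close> by \<open>cos (pi * x)\<close>
    averages the sines of index \<open>i + 1\<close> and \<open>i - 1\<close>; hence the induction
    on \<open>k\<close> must keep \<open>i\<close> arbitrary.\<close>
  have power: "(LINT x|unit_leb. f x * (sin (real i * pi * x) * cos (pi * x) ^ k)) = 0" for i k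
  proof (induction k arbitrary: i)
    case 0
    then show ?case using sin0 by simp
  next
    case (Suc k)
    show ?case
    proof (cases i)
      case (Suc j)
      have alg: "f * (s * c ^ Suc k) = f * (a * c ^ k) / 2 + f * (b * c ^ k) / 2"
        if "s * c = (a + b) / 2" for f s c a b :: real
      proof -
        have "f * (s * c ^ Suc k) = f * (s * c) * c ^ k" by simp
        then show ?thesis by (simp only: that) (simp add: algebra_simps)
      qed
      have "sin (real i * pi * x) * cos (pi * x) =
          (sin (real (Suc i) * pi * x) + sin (real j * pi * x)) / 2" for x
      proof -
        have "real i * pi * x + pi * x = real (Suc i) * pi * x" "real i * pi * x - pi * x = real j * pi * x"
          using Suc by (simp_all add: distrib_right left_diff_distrib)
        then show ?thesis by (simp only: sin_times_cos)
      qed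
      then have "f x * (sin (real i * pi * x) * cos (pi * x) ^ Suc k) =
          f x * (sin (real (Suc i) * pi * x) * cos (pi * x) ^ k) / 2 +
          f x * (sin (real j * pi * x) * cos (pi * x) ^ k) / 2" for x
        by (rule alg)
      then show ?thesis
        using Suc.IH int
        by (simp del: power_Suc of_nat_Suc add: continuous_intros)
    qed simp
  qed
  have poly: "(LINT x|unit_leb. f x * (sin (pi * x) * p (cos (pi * x)))) = 0"
    if p: "real_polynomial_function p" for p
  proof -
    obtain a n where p: "p = (\<lambda>y. \<Sum>i\<le>n. a i * y ^ i)"
      using p by (auto simp: real_polynomial_function_iff_sum)
    have "f x * (sin (pi * x) * p (cos (pi * x))) =
        (\<Sum>k\<le>n. a k * (f x * (sin (real 1 * pi * x) * cos (pi * x) ^ k)))" for x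
      by (simp add: p sum_distrib_left mult_ac)
    moreover have "(LINT x|unit_leb. (\<Sum>k\<le>n. a k * (f x * (sin (real 1 * pi * x) * cos (pi * x) ^ k)))) =
        (\<Sum>k\<le>n. a k * (LINT x|unit_leb. f x * (sin (real 1 * pi * x) * cos (pi * x) ^ k)))"
      by (subst Bochner_Integration.integral_sum)
        (auto intro!: int integrable_mult_right continuous_intros simp del: of_nat_1)
    ultimately show ?thesis by (simp only: power) simp
  qed
  fix \<phi> \<phi>' assume t: "test_pair \<phi> \<phi>'"
  obtain K where K: "compact K" "K \<subseteq> {0<..<1}" "\<And>x. x \<notin> K \<Longrightarrow> \<phi> x = 0"
    using t unfolding test_pair_def by blast
  have c\<phi>: "continuous_on UNIV \<phi>"
    using t unfolding test_pair_def by (auto intro!: continuous_at_imp_continuous_on DERIV_isCont)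
  have sin_pos: "sin (pi * x) > 0" if "0 < x" "x < 1" for x
    using that by (intro sin_gt_zero) auto
  \<comment> \<open>The sine vanishes only where \<open>\<phi>\<close> already does:
    \<open>h\<close> is a quotient with positive denominator on the open interval and is 0 off
    \<open>K\<close>. These two open sets cover the line, so \<open>h\<close> is continuous
    everywhere.\<close>
  define h where "h x = \<phi> x / sin (pi * x)" for x
  have "continuous_on {0<..<1} h"
    unfolding h_def using sin_pos
    by (intro continuous_intros continuous_on_subset[OF c\<phi>]) (auto simp: less_imp_neq[symmetric])
  moreover have "continuous_on (- K) h"
    by (rule continuous_on_eq[of _ "\<lambda>_. 0"]) (auto simp: h_def K)
  ultimately have "continuous_on ({0<..<1} \<union> - K) h"
    using K(1) by (intro continuous_on_open_Un) (auto intro: compact_imp_closed)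
  moreover have "{0<..<1} \<union> - K = UNIV" using K(2) by auto
  ultimately have ch: "continuous_on UNIV h" by simp
  \<comment> \<open>This is \<open>h\<close> read in the variable \<open>y = cos (pi * x)\<close>,
    which maps the unit interval bijectively onto \<open>{-1..1}\<close>, so that polynomials in the
    cosine can approximate it.\<close>
  define g where "g y = h (arccos y / pi)" for y
  have cg: "continuous_on {-1..1} g"
    unfolding g_def
    by (rule continuous_on_compose2[OF ch])
      (auto intro!: continuous_intros)
  have \<phi>: "\<phi> x = sin (pi * x) * g (cos (pi * x))" if x: "0 < x" "x < 1" for x
    using sin_pos[OF x] x by (simp add: g_def h_def arccos_cos)
  define B where "B = (LINT x|unit_leb. \<bar>f x\<bar>)"
  have "B \<ge> 0" by (simp add: B_def)
  have "\<bar>LINT x|unit_leb. f x * \<phi> x\<bar> \<le> 0"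
  proof (rule field_le_epsilon)
    fix e :: real assume e: "e > 0"
    \<comment> \<open>The final error is at most \<open>B * d\<close>; adding 1 to the denominator
      covers the case \<open>B = 0\<close>.\<close>
    define d where "d = e / (B + 1)"
    have d: "d > 0" using e \<open>B \<ge> 0\<close> by (simp add: d_def)
    obtain p where p: "real_polynomial_function p" "\<And>y. y \<in> {-1..1} \<Longrightarrow> \<bar>g y - p y\<bar> < d"
      using Stone_Weierstrass_real_polynomial_function[OF compact_Icc cg d] by blast
    have "continuous_on UNIV p"
      using p(1) by (auto intro!: continuous_at_imp_continuous_on continuous_real_polymonial_function)
    then have cp: "continuous_on UNIV (\<lambda>x. p (cos (pi * x)))"
      by (rule continuous_on_compose2) (auto intro!: continuous_intros)
    have i: "integrable unit_leb (\<lambda>x. f x * \<phi> x)"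
      "integrable unit_leb (\<lambda>x. f x * (sin (pi * x) * p (cos (pi * x))))"
      by (intro int c\<phi> continuous_intros cp)+
    have "(LINT x|unit_leb. f x * \<phi> x) =
        (LINT x|unit_leb. f x * \<phi> x - f x * (sin (pi * x) * p (cos (pi * x))))"
      using i poly[OF p(1)] by simp
    also have "\<bar>\<dots>\<bar> \<le> (LINT x|unit_leb. \<bar>f x\<bar> * d)"
    proof (rule integral_abs_bound_integral)
      fix x assume "x \<in> space unit_leb"
      then have x: "0 < x" "x < 1" by auto
      have "\<bar>\<phi> x - sin (pi * x) * p (cos (pi * x))\<bar> =
          \<bar>sin (pi * x)\<bar> * \<bar>g (cos (pi * x)) - p (cos (pi * x))\<bar>"
        unfolding \<phi>[OF x] abs_mult[symmetric] by (simp add: right_diff_distrib)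
      also have "\<dots> \<le> 1 * d"
        by (intro mult_mono less_imp_le[OF p(2)]) auto
      finally have "\<bar>f x\<bar> * \<bar>\<phi> x - sin (pi * x) * p (cos (pi * x))\<bar> \<le> \<bar>f x\<bar> * d"
        by (intro mult_left_mono) auto
      then show "\<bar>f x * \<phi> x - f x * (sin (pi * x) * p (cos (pi * x)))\<bar> \<le> \<bar>f x\<bar> * d"
        unfolding abs_mult[symmetric] by (simp only: right_diff_distrib)
    qed (use i fi in auto)
    also have "\<dots> = B * d" by (simp add: B_def)
    also have "\<dots> \<le> e" using \<open>B \<ge> 0\<close> e by (simp add: d_def field_simps)
    finally show "\<bar>LINT x|unit_leb. f x * \<phi> x\<bar> \<le> 0 + e" by simp
  qed
  then show "(LINT x|unit_leb. rep_L2 w x * \<phi> x) = 0" by (simp add: f_def)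
qed

lemma L2_eqI_e_basis:
  assumes "\<And>i. u \<bullet> e_basis (Suc i) = v \<bullet> e_basis (Suc i)"
  shows "u = v"
proof -
  have "(u - v) \<bullet> e_basis i = 0" if "i \<ge> 1" for i
    using that assms[of "i - 1"] by (simp add: inner_diff_left)
  then show ?thesis using orthogonal_e_basis_imp_eq_0[of "u - v"] by simp
qed

section \<open>Bessel's inequality and Fourier expansion in the sine basis\<close>

lemma inner_sum_e_basis:
  assumes "finite I" "I \<subseteq> {1..}" "j \<ge> 1"
  shows "(\<Sum>i\<in>I. c i *\<^sub>R e_basis i) \<bullet> e_basis j = (if j \<in> I then c j else 0)"
proof -
  have "(\<Sum>i\<in>I. c i *\<^sub>R e_basis i) \<bullet> e_basis j = (\<Sum>i\<in>I. c i * (if i = j then 1 else 0))"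
    unfolding inner_sum_left inner_scaleR_left
    using assms by (intro sum.cong refl) (auto simp: inner_e_basis)
  then show ?thesis using assms(1) by (simp add: if_distrib cong: if_cong)
qed

lemma norm_sum_e_basis:
  assumes I: "finite I" "I \<subseteq> {1..}"
  shows "(norm (\<Sum>i\<in>I. c i *\<^sub>R e_basis i))\<^sup>2 = (\<Sum>i\<in>I. (c i)\<^sup>2)"
proof -
  let ?s = "\<Sum>i\<in>I. c i *\<^sub>R e_basis i"
  have "?s \<bullet> ?s = (\<Sum>i\<in>I. c i * (?s \<bullet> e_basis i))"
    by (subst inner_sum_right) simp
  also have "\<dots> = (\<Sum>i\<in>I. (c i)\<^sup>2)"
  proof (rule sum.cong[OF refl])
    fix i assume "i \<in> I"
    then show "c i * (?s \<bullet> e_basis i) = (c i)\<^sup>2"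
      using I inner_sum_e_basis[OF I, of i c] by (auto simp: power2_eq_square)
  qed
  finally show ?thesis by (simp add: power2_norm_eq_inner)
qed

lemma bessel_e_basis:
  assumes I: "finite I" "I \<subseteq> {1..}"
  shows "(\<Sum>i\<in>I. (u \<bullet> e_basis i)\<^sup>2) \<le> (norm u)\<^sup>2"
proof -
  let ?s = "\<Sum>i\<in>I. (u \<bullet> e_basis i) *\<^sub>R e_basis i"
  have "u \<bullet> ?s = (\<Sum>i\<in>I. (u \<bullet> e_basis i)\<^sup>2)"
    by (simp add: inner_sum_right power2_eq_square)
  moreover have "(norm (u - ?s))\<^sup>2 = (norm u)\<^sup>2 - 2 * (u \<bullet> ?s) + (norm ?s)\<^sup>2"
    by (simp add: power2_norm_eq_inner inner_diff_left inner_diff_right inner_commute)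
  ultimately show ?thesis
    using norm_sum_e_basis[OF I, of "\<lambda>i. u \<bullet> e_basis i"] zero_le_power2[of "norm (u - ?s)"] by linarith
qed

lemma summable_e_basis_coeffs: "summable (\<lambda>i. (u \<bullet> e_basis (Suc i))\<^sup>2)"
proof (rule summableI_nonneg_bounded)
  fix n
  have "(\<Sum>i<n. (u \<bullet> e_basis (Suc i))\<^sup>2) = (\<Sum>i\<in>Suc ` {..<n}. (u \<bullet> e_basis i)\<^sup>2)"
    by (simp add: sum.reindex)
  also have "\<dots> \<le> (norm u)\<^sup>2" by (rule bessel_e_basis) auto
  finally show "(\<Sum>i<n. (u \<bullet> e_basis (Suc i))\<^sup>2) \<le> (norm u)\<^sup>2" .
qed simp

lemma norm_sum_Suc_e_basis:
  assumes "finite I"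
  shows "(norm (\<Sum>i\<in>I. c i *\<^sub>R e_basis (Suc i)))\<^sup>2 = (\<Sum>i\<in>I. (c i)\<^sup>2)"
  using norm_sum_e_basis[of "Suc ` I" "\<lambda>i. c (i - 1)"] assms
  by (simp add: sum.reindex image_subset_iff)

text \<open>By Pythagoras the squared norm of a block of the series is the same block of the series
  of squares, so the partial sums are Cauchy and completeness of \<open>L2\<close> gives the
  limit.\<close>

lemma summable_e_basis_series:
  assumes "summable (\<lambda>i. (c i)\<^sup>2)"
  shows "summable (\<lambda>i. c i *\<^sub>R e_basis (Suc i))"
  unfolding summable_Cauchy
proof (intro allI impI)
  fix e :: real assume e: "e > 0"
  then have "e\<^sup>2 > 0" by simp
  then obtain N where N: "\<And>m n. m \<ge> N \<Longrightarrow> norm (\<Sum>i\<in>{m..<n}. (c i)\<^sup>2) < e\<^sup>2"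
    using assms unfolding summable_Cauchy by metis
  have "norm (\<Sum>i\<in>{m..<n}. c i *\<^sub>R e_basis (Suc i)) < e" if "m \<ge> N" for m n
  proof (rule power2_less_imp_less)
    show "(norm (\<Sum>i\<in>{m..<n}. c i *\<^sub>R e_basis (Suc i)))\<^sup>2 < e\<^sup>2"
      using N[OF that, of n] by (simp add: norm_sum_Suc_e_basis)
  qed (use e in simp)
  then show "\<exists>N. \<forall>m\<ge>N. \<forall>n. norm (\<Sum>i\<in>{m..<n}. c i *\<^sub>R e_basis (Suc i)) < e" by blast
qed

lemma inner_suminf_e_basis:
  assumes "summable (\<lambda>i. (c i)\<^sup>2)"
  shows "(\<Sum>i. c i *\<^sub>R e_basis (Suc i)) \<bullet> e_basis (Suc j) = c j"
proof -
  have "(\<lambda>i. (c i *\<^sub>R e_basis (Suc i)) \<bullet> e_basis (Suc j)) sums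
      ((\<Sum>i. c i *\<^sub>R e_basis (Suc i)) \<bullet> e_basis (Suc j))"
    by (rule bounded_linear.sums[OF bounded_linear_inner_left
          summable_sums[OF summable_e_basis_series[OF assms]]])
  moreover have "(\<lambda>i. (c i *\<^sub>R e_basis (Suc i)) \<bullet> e_basis (Suc j)) = (\<lambda>i. if i = j then c i else 0)"
    by (auto simp: inner_e_basis)
  ultimately show ?thesis using sums_single[of j c] sums_unique2 by metis
qed

text \<open>The series converges to an element with the same coefficients as \<open>u\<close>, and
  completeness of the basis identifies the two.\<close>

lemma e_basis_expansion: "(\<lambda>i. (u \<bullet> e_basis (Suc i)) *\<^sub>R e_basis (Suc i)) sums u"
proof -
  have "u = (\<Sum>i. (u \<bullet> e_basis (Suc i)) *\<^sub>R e_basis (Suc i))"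
    by (rule L2_eqI_e_basis) (simp add: inner_suminf_e_basis summable_e_basis_coeffs)
  then show ?thesis
    using summable_sums[OF summable_e_basis_series[OF summable_e_basis_coeffs[of u]]] by simp
qed


section \<open>Diagonal operators and the square root of \<open>Q\<close>\<close>

text \<open>Common form of the heat semigroup and of the square root of \<open>Q\<close>. The
  multiplier \<open>c i\<close> belongs to mode \<open>Suc i\<close>, in line with the series in
  \<open>spectral\<close>.\<close>

definition diag_op :: "(nat \<Rightarrow> real) \<Rightarrow> L2 \<Rightarrow> L2" where
  "diag_op c u = (\<Sum>i. (c i * (u \<bullet> e_basis (Suc i))) *\<^sub>R e_basis (Suc i))"

lemma summable_diag_op:
  assumes "\<And>i. \<bar>c i\<bar> \<le> B"
  shows "summable (\<lambda>i. (c i * (u \<bullet> e_basis (Suc i)))\<^sup>2)"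
proof (rule summable_comparison_test)
  have "norm ((c i * (u \<bullet> e_basis (Suc i)))\<^sup>2) \<le> B\<^sup>2 * (u \<bullet> e_basis (Suc i))\<^sup>2" for i
    using power_mono[OF assms[of i], of 2] by (simp add: power_mult_distrib mult_right_mono)
  then show "\<exists>N. \<forall>i\<ge>N. norm ((c i * (u \<bullet> e_basis (Suc i)))\<^sup>2) \<le> B\<^sup>2 * (u \<bullet> e_basis (Suc i))\<^sup>2"
    by blast
  show "summable (\<lambda>i. B\<^sup>2 * (u \<bullet> e_basis (Suc i))\<^sup>2)"
    by (intro summable_mult summable_e_basis_coeffs)
qed

lemma inner_diag_op_e_basis:
  assumes "\<And>i. \<bar>c i\<bar> \<le> B"
  shows "diag_op c u \<bullet> e_basis (Suc j) = c j * (u \<bullet> e_basis (Suc j))"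
  unfolding diag_op_def by (rule inner_suminf_e_basis[OF summable_diag_op[OF assms]])

lemma inner_diag_op:
  assumes "\<And>i. \<bar>c i\<bar> \<le> B"
  shows "(\<lambda>i. c i * (u \<bullet> e_basis (Suc i)) * (v \<bullet> e_basis (Suc i))) sums (diag_op c u \<bullet> v)"
  using bounded_linear.sums[OF bounded_linear_inner_left[of v]
      summable_sums[OF summable_e_basis_series[OF summable_diag_op[of c B u, OF assms]]]]
  by (simp add: diag_op_def inner_commute[of v])

lemma norm_diag_op_le:
  assumes c: "\<And>i. \<bar>c i\<bar> \<le> B"
  shows "norm (diag_op c u) \<le> B * norm u"
proof (rule LIMSEQ_le_const2)
  show "(\<lambda>n. norm (\<Sum>i<n. (c i * (u \<bullet> e_basis (Suc i))) *\<^sub>R e_basis (Suc i))) \<longlonglongrightarrow> norm (diag_op c u)"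
    unfolding diag_op_def
    by (intro tendsto_norm summable_LIMSEQ summable_e_basis_series summable_diag_op[OF c])
  have "B \<ge> 0" using c[of 0] by simp
  have "norm (\<Sum>i<n. (c i * (u \<bullet> e_basis (Suc i))) *\<^sub>R e_basis (Suc i)) \<le> B * norm u" for n
  proof (rule power2_le_imp_le)
    have "(norm (\<Sum>i<n. (c i * (u \<bullet> e_basis (Suc i))) *\<^sub>R e_basis (Suc i)))\<^sup>2 =
        (\<Sum>i<n. (c i)\<^sup>2 * (u \<bullet> e_basis (Suc i))\<^sup>2)"
      by (simp add: norm_sum_Suc_e_basis power_mult_distrib)
    also have "\<dots> \<le> (\<Sum>i<n. B\<^sup>2 * (u \<bullet> e_basis (Suc i))\<^sup>2)"
    proof (intro sum_mono mult_right_mono)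
      show "(c i)\<^sup>2 \<le> B\<^sup>2" for i using power_mono[OF c[of i], of 2] by simp
    qed simp
    also have "\<dots> = B\<^sup>2 * (\<Sum>i\<in>Suc ` {..<n}. (u \<bullet> e_basis i)\<^sup>2)"
      by (simp add: sum.reindex sum_distrib_left)
    also have "\<dots> \<le> B\<^sup>2 * (norm u)\<^sup>2"
      by (intro mult_left_mono bessel_e_basis) auto
    finally show "(norm (\<Sum>i<n. (c i * (u \<bullet> e_basis (Suc i))) *\<^sub>R e_basis (Suc i)))\<^sup>2 \<le> (B * norm u)\<^sup>2"
      by (simp add: power_mult_distrib)
  qed (use \<open>B \<ge> 0\<close> in simp)
  then show "\<exists>N. \<forall>n\<ge>N. norm (\<Sum>i<n. (c i * (u \<bullet> e_basis (Suc i))) *\<^sub>R e_basis (Suc i)) \<le> B * norm u"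
    by blast
qed

lemma bounded_linear_diag_op:
  assumes c: "\<And>i. \<bar>c i\<bar> \<le> B"
  shows "bounded_linear (diag_op c)"
proof (rule bounded_linear_intro[where K = B])
  show "diag_op c (u + v) = diag_op c u + diag_op c v" for u v
    by (rule L2_eqI_e_basis)
      (simp add: inner_add_left inner_diag_op_e_basis[where c = c, OF c] distrib_left)
  show "diag_op c (r *\<^sub>R u) = r *\<^sub>R diag_op c u" for r u
    by (rule L2_eqI_e_basis) (simp add: inner_diag_op_e_basis[where c = c, OF c])
  show "norm (diag_op c u) \<le> norm u * B" for u
    using norm_diag_op_le[where c = c, OF c, of u] by (simp add: mult.commute)
qed

lemma self_adjoint_diag_op:
  assumes c: "\<And>i. \<bar>c i\<bar> \<le> B"
  shows "self_adjoint (diag_op c)"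
  unfolding self_adjoint_def
proof (intro allI)
  fix u v
  show "diag_op c u \<bullet> v = u \<bullet> diag_op c v"
    using inner_diag_op[where c = c, OF c, of u v] inner_diag_op[where c = c, OF c, of v u]
    by (simp add: inner_commute[of u] mult.commute mult.left_commute sums_unique2)
qed

text \<open>For nonnegative times all multipliers lie between 0 and 1, so the semigroup is a bounded
  diagonal operator.\<close>

lemma inner_heat_semigroup:
  assumes "t \<ge> 0" "i \<ge> 1"
  shows "heat_semigroup t u \<bullet> e_basis i = exp (- eigval i * t) * (u \<bullet> e_basis i)"
proof -
  have "eigval (Suc j) * t \<ge> 0" for j
    using assms(1) by (simp add: eigval_def)
  then have b: "\<bar>exp (- eigval (Suc j) * t)\<bar> \<le> 1" for j by simp
  have "heat_semigroup t = diag_op (\<lambda>j. exp (- eigval (Suc j) * t))"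
    by (intro ext) (simp add: heat_semigroup_def spectral_def diag_op_def)
  then show ?thesis
    using inner_diag_op_e_basis[where c = "\<lambda>j. exp (- eigval (Suc j) * t)", OF b, of u "i - 1"] assms(2)
    by simp
qed

section \<open>Eigenvalues of Q and its square root\<close>

lemma norm_e_basis: "i \<ge> 1 \<Longrightarrow> norm (e_basis i) = 1"
  by (simp add: norm_eq_sqrt_inner inner_e_basis)

lemma eigenvalue_le_onorm:
  assumes "bounded_linear Q" "i \<ge> 1" "Q (e_basis i) = l *\<^sub>R e_basis i"
  shows "l \<le> onorm Q"
  using onorm[OF assms(1), of "e_basis i"] assms(2,3) by (simp add: norm_e_basis)

text \<open>The diagonal operator with multipliers \<open>sqrt (q i)\<close> is a root of the
  required kind. As \<open>op_sqrt\<close> is a definite description, uniqueness is needed as well: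
  any other such root is shown to act in the same way on each basis vector.\<close>

lemma op_sqrt_e_basis:
  assumes Q: "bounded_linear Q" "self_adjoint Q"
    and eigen: "\<And>i. i \<ge> 1 \<Longrightarrow> q i > 0 \<and> Q (e_basis i) = q i *\<^sub>R e_basis i"
    and i: "i \<ge> 1"
  shows "op_sqrt Q v \<bullet> e_basis i = sqrt (q i) * (v \<bullet> e_basis i)"
proof -
  define R where "R = diag_op (\<lambda>i. sqrt (q (Suc i)))"
  define P where "P R' \<longleftrightarrow> bounded_linear R' \<and> self_adjoint R' \<and> (\<forall>u. 0 \<le> R' u \<bullet> u) \<and> R' \<circ> R' = Q" for R'
  have b: "\<bar>sqrt (q (Suc i))\<bar> \<le> sqrt (onorm Q)" for i
    using eigenvalue_le_onorm[OF Q(1), of "Suc i"] eigen[of "Suc i"] by simp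
  have R_inner: "R u \<bullet> e_basis (Suc i) = sqrt (q (Suc i)) * (u \<bullet> e_basis (Suc i))" for u i
    unfolding R_def by (rule inner_diag_op_e_basis[OF b])
  have Q_inner: "Q u \<bullet> e_basis (Suc i) = q (Suc i) * (u \<bullet> e_basis (Suc i))" for u i
    using Q(2) eigen[of "Suc i"] by (simp add: self_adjoint_def)
  have PR: "P R"
    unfolding P_def
  proof (intro conjI allI)
    show "bounded_linear R" unfolding R_def by (rule bounded_linear_diag_op[OF b])
    show "self_adjoint R" unfolding R_def by (rule self_adjoint_diag_op[OF b])
    show "0 \<le> R u \<bullet> u" for u
    proof (rule sums_le[OF _ sums_zero])
      show "(\<lambda>i. sqrt (q (Suc i)) * (u \<bullet> e_basis (Suc i)) * (u \<bullet> e_basis (Suc i))) sums (R u \<bullet> u)"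
        unfolding R_def by (rule inner_diag_op[OF b])
      show "0 \<le> sqrt (q (Suc i)) * (u \<bullet> e_basis (Suc i)) * (u \<bullet> e_basis (Suc i))" for i
        using eigen[of "Suc i"] by (simp add: mult.assoc)
    qed
    show "R \<circ> R = Q"
    proof
      fix u
      show "(R \<circ> R) u = Q u"
        using eigen
        by (intro L2_eqI_e_basis)
          (simp add: R_inner Q_inner mult.assoc[symmetric] less_imp_le)
    qed
  qed
  \<comment> \<open>\<open>x = R' e\<^sub>i - \<surd>q\<^sub>i e\<^sub>i\<close> satisfies \<open>R' x = - \<surd>q\<^sub>i x\<close>, so positivity of \<open>R'\<close> forces \<open>x = 0\<close>.\<close>
  have unique: "R' = R" if R': "P R'" for R'
  proof
    fix u
    have lin: "linear R'" and sa: "\<And>u v. R' u \<bullet> v = u \<bullet> R' v" and pos: "\<And>u. 0 \<le> R' u \<bullet> u"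
      and sq: "\<And>u. R' (R' u) = Q u"
      using R' unfolding P_def self_adjoint_def by (auto simp: bounded_linear.linear fun_eq_iff)
    have e: "R' (e_basis (Suc i)) = sqrt (q (Suc i)) *\<^sub>R e_basis (Suc i)" for i
    proof -
      define s where "s = sqrt (q (Suc i))"
      define x where "x = R' (e_basis (Suc i)) - s *\<^sub>R e_basis (Suc i)"
      have s: "s > 0" "s * s = q (Suc i)" using eigen[of "Suc i"] by (auto simp: s_def)
      have "R' x = q (Suc i) *\<^sub>R e_basis (Suc i) - s *\<^sub>R R' (e_basis (Suc i))"
        using eigen[of "Suc i"] by (simp add: x_def linear_diff[OF lin] linear_cmul[OF lin] sq)
      also have "\<dots> = - s *\<^sub>R x" by (simp add: x_def s(2)[symmetric] scaleR_diff_right)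
      finally have "0 \<le> - (s * (x \<bullet> x))" using pos[of x] by simp
      then have "x \<bullet> x \<le> 0" using s(1) by (simp add: mult_le_0_iff)
      then have "x = 0" using inner_ge_zero[of x] inner_eq_zero_iff[of x] by linarith
      then show ?thesis by (simp add: x_def s_def)
    qed
    \<comment> \<open>Self-adjointness moves \<open>R'\<close> onto the basis vector, so agreement
      on the basis determines every coefficient of \<open>R' u\<close>.\<close>
    show "R' u = R u"
      by (rule L2_eqI_e_basis) (simp add: R_inner sa e)
  qed
  have "op_sqrt Q = R"
    unfolding op_sqrt_def P_def[symmetric] by (rule the_equality[where P = P]) (use PR unique in blast)+
  then show ?thesis using R_inner[of v "i - 1"] i by simp
qed


section \<open>The discrete semigroup\<close>

lemma sum_in_H_fin: "(\<Sum>i\<in>{1..n}. a i *\<^sub>R e_basis i) \<in> H_fin n"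
  unfolding H_fin_def by (intro span_sum span_scale span_base) blast

lemma H_fin_eq: "H_fin n = range (\<lambda>a. \<Sum>i\<in>{1..n}. a i *\<^sub>R e_basis i)"
proof
  show "range (\<lambda>a. \<Sum>i\<in>{1..n}. a i *\<^sub>R e_basis i) \<subseteq> H_fin n"
    using sum_in_H_fin by blast
  have "inj_on e_basis {1..n}"
  proof (rule inj_onI)
    fix i j assume "i \<in> {1..n}" "j \<in> {1..n}" "e_basis i = e_basis j"
    then show "i = j"
      using inner_e_basis[of i j] inner_e_basis[of j j] by (auto split: if_splits)
  qed
  show "H_fin n \<subseteq> range (\<lambda>a. \<Sum>i\<in>{1..n}. a i *\<^sub>R e_basis i)"
  proof
    fix u assume "u \<in> H_fin n"
    then obtain b where "u = (\<Sum>v\<in>e_basis ` {1..n}. b v *\<^sub>R v)"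
      unfolding H_fin_def by (subst (asm) span_finite) auto
    also have "\<dots> = (\<Sum>i\<in>{1..n}. b (e_basis i) *\<^sub>R e_basis i)"
      by (subst sum.reindex[OF \<open>inj_on e_basis {1..n}\<close>]) simp
    finally show "u \<in> range (\<lambda>a. \<Sum>i\<in>{1..n}. a i *\<^sub>R e_basis i)"
      by (rule range_eqI[where x = "\<lambda>i. b (e_basis i)"])
  qed
qed

lemma H_fin_expansion:
  assumes "u \<in> H_fin n"
  shows "u = (\<Sum>i\<in>{1..n}. (u \<bullet> e_basis i) *\<^sub>R e_basis i)"
proof -
  obtain a where u: "u = (\<Sum>i\<in>{1..n}. a i *\<^sub>R e_basis i)"
    using assms by (auto simp: H_fin_eq)
  have "u \<bullet> e_basis i = a i" if "i \<in> {1..n}" for i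
    unfolding u using that by (subst inner_sum_e_basis) auto
  then have "(\<Sum>i\<in>{1..n}. (u \<bullet> e_basis i) *\<^sub>R e_basis i) = (\<Sum>i\<in>{1..n}. a i *\<^sub>R e_basis i)"
    by (intro sum.cong) auto
  then show ?thesis using u by simp
qed

lemma proj_eq: "proj n u = (\<Sum>i\<in>{1..n}. (u \<bullet> e_basis i) *\<^sub>R e_basis i)"
  unfolding proj_def
proof (rule the_equality)
  let ?p = "\<Sum>i\<in>{1..n}. (u \<bullet> e_basis i) *\<^sub>R e_basis i"
  have p: "?p \<in> H_fin n" by (rule sum_in_H_fin)
  have orth: "(u - ?p) \<bullet> v = 0" if "v \<in> H_fin n" for v
  proof -
    obtain a where v: "v = (\<Sum>i\<in>{1..n}. a i *\<^sub>R e_basis i)"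
      using \<open>v \<in> H_fin n\<close> by (auto simp: H_fin_eq)
    have "(u - ?p) \<bullet> e_basis i = 0" if "i \<in> {1..n}" for i
      using that inner_sum_e_basis[of "{1..n}" i "\<lambda>i. u \<bullet> e_basis i"]
      by (simp add: inner_diff_left)
    then show ?thesis unfolding v inner_sum_right by (intro sum.neutral) auto
  qed
  show "?p \<in> H_fin n \<and> (\<forall>v\<in>H_fin n. (u - ?p) \<bullet> v = 0)" using p orth by blast
  fix p' assume p': "p' \<in> H_fin n \<and> (\<forall>v\<in>H_fin n. (u - p') \<bullet> v = 0)"
  have "?p - p' \<in> H_fin n"
    using p p' unfolding H_fin_def by (simp add: span_diff)
  \<comment> \<open>The difference of the two residuals is \<open>?p - p'\<close> itself; it lies in
    \<open>H_fin n\<close> and is orthogonal to that space, hence to itself.\<close>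
  then have "((u - p') - (u - ?p)) \<bullet> (?p - p') = 0"
    using orth p' by (simp add: inner_diff_left)
  then show "p' = ?p" by simp
qed

lemma proj_in_H_fin: "proj n u \<in> H_fin n"
  unfolding proj_eq by (rule sum_in_H_fin)

lemma inner_proj: "i \<in> {1..n} \<Longrightarrow> proj n u \<bullet> e_basis i = u \<bullet> e_basis i"
  unfolding proj_eq by (subst inner_sum_e_basis) auto

lemma proj_tendsto: "(\<lambda>n. proj n u) \<longlonglongrightarrow> u"
proof -
  have "proj n u = (\<Sum>i<n. (u \<bullet> e_basis (Suc i)) *\<^sub>R e_basis (Suc i))" for n
    by (simp add: proj_eq sum.atLeast1_atMost_eq)
  then show ?thesis using e_basis_expansion[of u] by (simp add: sums_def)
qed

section \<open>The Laplacian and its exponential on finite sine sums\<close>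

lemma test_pair_continuous:
  assumes "test_pair \<phi> \<phi>'"
  shows "continuous_on UNIV \<phi>" "continuous_on UNIV \<phi>'"
  using assms unfolding test_pair_def
  by (auto intro!: continuous_at_imp_continuous_on DERIV_isCont)

text \<open>Written with inner products, the condition is visibly linear in \<open>u\<close> and
  \<open>v\<close>, free of any choice of representatives.\<close>

lemma weak_deriv_inner_iff:
  "weak_deriv u v \<longleftrightarrow> (\<forall>\<phi> \<phi>'. test_pair \<phi> \<phi>' \<longrightarrow> u \<bullet> abs_L2 \<phi>' = - (v \<bullet> abs_L2 \<phi>))"
proof -
  have "u \<bullet> abs_L2 h = (LINT x|unit_leb. rep_L2 u x * h x)" if "continuous_on UNIV h" for u h
    using inner_abs_L2[OF sq_integrable_rep[of u] sq_integrable_continuous[OF that]] by simp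
  then show ?thesis unfolding weak_deriv_iff by (auto simp: test_pair_continuous)
qed

lemma weak_deriv_sum:
  assumes "\<And>i. i \<in> I \<Longrightarrow> weak_deriv (u i) (v i)"
  shows "weak_deriv (\<Sum>i\<in>I. a i *\<^sub>R u i) (\<Sum>i\<in>I. a i *\<^sub>R v i)"
  using assms unfolding weak_deriv_inner_iff
  by (auto simp: inner_sum_left sum_negf[symmetric] intro!: sum.cong)

text \<open>\<open>lap\<close> is a definite description, so linearity is not immediate. Weak
  derivatives of the modes are combined twice, and their uniqueness then fixes the value.\<close>

lemma lap_sum_e_basis:
  "lap (\<Sum>i\<in>I. a i *\<^sub>R e_basis i) = (\<Sum>i\<in>I. (- eigval i * a i) *\<^sub>R e_basis i)"
proof -
  define v where "v i = abs_L2 (\<lambda>x. sqrt 2 * (real i * pi) * cos (real i * pi * x))" for i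
  have "weak_deriv (\<Sum>i\<in>I. a i *\<^sub>R e_basis i) (\<Sum>i\<in>I. a i *\<^sub>R v i)"
    "weak_deriv (\<Sum>i\<in>I. a i *\<^sub>R v i) (\<Sum>i\<in>I. a i *\<^sub>R (- eigval i *\<^sub>R e_basis i))"
    unfolding v_def by (intro weak_deriv_sum weak_deriv_e_basis)+
  then have "lap (\<Sum>i\<in>I. a i *\<^sub>R e_basis i) = (\<Sum>i\<in>I. a i *\<^sub>R (- eigval i *\<^sub>R e_basis i))"
    unfolding lap_def by (intro the_equality) (auto dest: weak_deriv_unique)
  then show ?thesis by (simp add: mult.commute)
qed

lemma lap_fin_power_sum:
  "(lap_fin n ^^ k) (\<Sum>i\<in>{1..n}. a i *\<^sub>R e_basis i) = (\<Sum>i\<in>{1..n}. ((- eigval i) ^ k * a i) *\<^sub>R e_basis i)"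
proof (induction k)
  case (Suc k)
  have "(lap_fin n ^^ Suc k) (\<Sum>i\<in>{1..n}. a i *\<^sub>R e_basis i) =
      proj n (\<Sum>i\<in>{1..n}. (- eigval i * ((- eigval i) ^ k * a i)) *\<^sub>R e_basis i)"
    by (simp only: funpow.simps comp_apply Suc lap_fin_def lap_sum_e_basis)
  \<comment> \<open>The Laplacian maps \<open>H_fin n\<close> into itself, so the projection acts as
    the identity here.\<close>
  also have "\<dots> = (\<Sum>i\<in>{1..n}. (- eigval i * ((- eigval i) ^ k * a i)) *\<^sub>R e_basis i)"
    unfolding proj_eq by (rule H_fin_expansion[symmetric]) (rule sum_in_H_fin)
  finally show ?case by (simp only: power_Suc mult.assoc)
qed simp

lemma semigroup_fin_sum:
  "semigroup_fin n t (\<Sum>i\<in>{1..n}. a i *\<^sub>R e_basis i) =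
     (\<Sum>i\<in>{1..n}. (exp (- eigval i * t) * a i) *\<^sub>R e_basis i)"
proof -
  have "(\<lambda>k. \<Sum>i\<in>{1..n}. ((- eigval i * t) ^ k /\<^sub>R fact k * a i) *\<^sub>R e_basis i) sums
      (\<Sum>i\<in>{1..n}. (exp (- eigval i * t) * a i) *\<^sub>R e_basis i)"
    by (intro sums_sum bounded_linear.sums[OF bounded_linear_scaleR_left] sums_mult2 exp_converges)
  moreover have "(t ^ k / fact k) *\<^sub>R (lap_fin n ^^ k) (\<Sum>i\<in>{1..n}. a i *\<^sub>R e_basis i) =
      (\<Sum>i\<in>{1..n}. ((- eigval i * t) ^ k /\<^sub>R fact k * a i) *\<^sub>R e_basis i)" for k
    unfolding lap_fin_power_sum scaleR_sum_right power_mult_distrib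
    by (intro sum.cong refl) (simp add: field_simps)
  ultimately show ?thesis unfolding semigroup_fin_def by (simp add: sums_iff)
qed

lemma semigroup_fin_H_fin:
  assumes "u \<in> H_fin n"
  shows "semigroup_fin n t u = (\<Sum>i\<in>{1..n}. (exp (- eigval i * t) * (u \<bullet> e_basis i)) *\<^sub>R e_basis i)"
  by (subst H_fin_expansion[OF assms]) (rule semigroup_fin_sum)

lemma inner_semigroup_fin:
  assumes "u \<in> H_fin n" "i \<in> {1..n}"
  shows "semigroup_fin n t u \<bullet> e_basis i = exp (- eigval i * t) * (u \<bullet> e_basis i)"
  unfolding semigroup_fin_H_fin[OF assms(1)] using assms(2) by (subst inner_sum_e_basis) auto


section \<open>The control problem\<close>

text \<open>This is the squared norm of \<open>Q^{-1/2} (-A)^{1/2} P_n u\<close>. Each term is half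
  the squared coefficient divided by \<open>q i / (2 * eigval i)\<close>, the controllability
  Gramian of that mode on an infinite horizon.\<close>

definition mode_cost :: "(nat \<Rightarrow> real) \<Rightarrow> nat \<Rightarrow> L2 \<Rightarrow> real" where
  "mode_cost q n u = (\<Sum>i\<in>{1..n}. eigval i * (u \<bullet> e_basis i)\<^sup>2 / q i)"

lemma eigval_pos: "i \<ge> 1 \<Longrightarrow> eigval i > 0"
  by (simp add: eigval_def)

text \<open>For \<open>t = T\<close> this is the Gramian integral of a mode with decay rate
  \<open>l\<close>; for \<open>t < T\<close> it is the state at time \<open>t\<close> under the
  control \<open>exp (- l * (T - s))\<close>.\<close>

lemma has_bochner_integral_exp_mult_exp:
  assumes "t \<ge> 0" "l \<noteq> 0"
  shows "has_bochner_integral lborel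
    (\<lambda>s. indicat_real {0..t} s * (exp (- l * (t - s)) * exp (- l * (T - s))))
    ((exp (- l * (T - t)) - exp (- l * (T + t))) / (2 * l))"
proof -
  have exp_eq: "exp (- l * (t - s)) * exp (- l * (T - s)) = exp (- l * (t + T - 2 * s))" for s
    unfolding exp_add[symmetric] by (rule arg_cong[of _ _ exp]) (simp add: algebra_simps)
  have "((\<lambda>s. exp (- l * (t + T - 2 * s)) / (2 * l)) has_real_derivative
      exp (- l * (t + T - 2 * s)) * (2 * l) / (2 * l)) (at s)" for s
    by (auto intro!: derivative_eq_intros)
  then have deriv: "((\<lambda>s. exp (- l * (t + T - 2 * s)) / (2 * l)) has_real_derivative
      exp (- l * (t + T - 2 * s))) (at s)" for s
    using assms(2) by simp
  have "has_bochner_integral lborel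
      (\<lambda>s. indicat_real {0..t} s *\<^sub>R exp (- l * (t + T - 2 * s)))
      (exp (- l * (t + T - 2 * t)) / (2 * l) - exp (- l * (t + T - 2 * 0)) / (2 * l))"
    by (intro has_bochner_integral_FTC_Icc assms continuous_intros)
      (use deriv in \<open>auto simp: has_real_derivative_iff_has_vector_derivative intro: has_vector_derivative_at_within\<close>)
  moreover have "t + T - 2 * t = T - t" "t + T - 2 * 0 = T + t" by simp_all
  ultimately show ?thesis
    unfolding exp_eq by (simp only: real_scaleR_def diff_divide_distrib)
qed

text \<open>In each mode the square of the control is at least \<open>2 * x * y - y^2\<close>, where
  \<open>x\<close> is the control and \<open>y\<close> a fixed multiple of the adjoint exponential.
  The integral of this bound depends on the control only through the end point \<open>u\<close>;
  Bessel's inequality adds up the modes. The integrand \<open>G\<close> is abstract so that the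
  continuous and the discrete problem are both covered.\<close>

lemma energy_ge_mode_cost:
  assumes \<phi>: "L2_path T \<phi>" and T: "T \<ge> 0" and q: "\<And>i. i \<ge> 1 \<Longrightarrow> q i > 0"
    and G: "set_integrable lborel {0..T} G" and u: "u = (LINT s:{0..T}|lborel. G s)"
    and modes: "\<And>i s. i \<in> {1..n} \<Longrightarrow> s \<in> {0..T} \<Longrightarrow>
      G s \<bullet> e_basis i = exp (- eigval i * (T - s)) * (sqrt (q i) * (\<phi> s \<bullet> e_basis i))"
  shows "2 * mode_cost q n u \<le> energy T \<phi>"
proof -
  \<comment> \<open>The maximiser over \<open>a\<close> of
    \<open>2 * a * (u \<bullet> e_basis i) - a^2 * q i / (2 * eigval i)\<close>; it uses the
    infinite horizon Gramian and is independent of \<open>T\<close>.\<close>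
  define a where "a i = 2 * eigval i * (u \<bullet> e_basis i) / q i" for i
  define E where "E i s = exp (- eigval i * (T - s))" for i s
  define v where "v i = (1 - exp (- eigval i * (T + T))) / (2 * eigval i)" for i
  \<comment> \<open>The linear term is written with \<open>G\<close> instead of the control, so that
    its integral is read off from \<open>u\<close>.\<close>
  define m where "m i s = 2 * a i * ((indicat_real {0..T} s *\<^sub>R G s) \<bullet> e_basis i) -
      (a i)\<^sup>2 * q i * (indicat_real {0..T} s * (E i s * E i s))" for i s
  have m_int: "has_bochner_integral lborel (m i) (2 * a i * (u \<bullet> e_basis i) - (a i)\<^sup>2 * q i * v i)"
    if "i \<in> {1..n}" for i
  proof -
    have "has_bochner_integral lborel (\<lambda>s. indicat_real {0..T} s *\<^sub>R G s) u"
      using G unfolding u set_integrable_def set_lebesgue_integral_def by (rule has_bochner_integral_integrable)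
    moreover have "has_bochner_integral lborel (\<lambda>s. indicat_real {0..T} s * (E i s * E i s)) (v i)"
      using has_bochner_integral_exp_mult_exp[OF T, of "eigval i" T] eigval_pos[of i] that
      by (simp add: v_def E_def)
    ultimately show ?thesis
      unfolding m_def
      by (intro has_bochner_integral_diff has_bochner_integral_mult_right has_bochner_integral_inner_left)
  qed
  have pointwise: "(\<Sum>i\<in>{1..n}. m i s) \<le> indicat_real {0..T} s * (norm (\<phi> s))\<^sup>2" for s
  proof (cases "s \<in> {0..T}")
    case True
    have "m i s \<le> (\<phi> s \<bullet> e_basis i)\<^sup>2" if i: "i \<in> {1..n}" for i
    proof -
      define y where "y = a i * sqrt (q i) * E i s"
      have sq: "sqrt (q i) * sqrt (q i) = q i" using q[of i] i by simp
      have alg: "2 * b * (e * (r * x)) - b\<^sup>2 * (r * r) * (e * e) = 2 * x * (b * r * e) - (b * r * e)\<^sup>2"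
        for b e r x :: real
        by algebra
      have "m i s = 2 * a i * (E i s * (sqrt (q i) * (\<phi> s \<bullet> e_basis i))) -
          (a i)\<^sup>2 * (sqrt (q i) * sqrt (q i)) * (E i s * E i s)"
        unfolding sq m_def inner_scaleR_left modes[OF i True] E_def using True by simp
      then have "m i s = 2 * (\<phi> s \<bullet> e_basis i) * y - y\<^sup>2"
        unfolding alg y_def .
      then show ?thesis using zero_le_power2[of "(\<phi> s \<bullet> e_basis i) - y"] by (simp add: power2_diff)
    qed
    then have "(\<Sum>i\<in>{1..n}. m i s) \<le> (\<Sum>i\<in>{1..n}. (\<phi> s \<bullet> e_basis i)\<^sup>2)"
      by (rule sum_mono)
    also have "\<dots> \<le> (norm (\<phi> s))\<^sup>2" by (rule bessel_e_basis) auto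
    finally show ?thesis using True by simp
  qed (simp add: m_def)
  have "2 * mode_cost q n u \<le> (\<Sum>i\<in>{1..n}. 2 * a i * (u \<bullet> e_basis i) - (a i)\<^sup>2 * q i * v i)"
    unfolding mode_cost_def sum_distrib_left
  proof (rule sum_mono)
    fix i assume "i \<in> {1..n}"
    then have l: "eigval i > 0" and qi: "q i > 0" using eigval_pos[of i] q[of i] by auto
    \<comment> \<open>Passing to the infinite horizon only enlarges the subtracted term, so the
      lower bound survives for every finite \<open>T\<close>.\<close>
    have "v i \<le> 1 / (2 * eigval i)" unfolding v_def using l by (intro divide_right_mono) auto
    then have "(a i)\<^sup>2 * q i * v i \<le> (a i)\<^sup>2 * q i * (1 / (2 * eigval i))"
      using qi by (intro mult_left_mono) auto
    moreover have "2 * a i * (u \<bullet> e_basis i) - (a i)\<^sup>2 * q i * (1 / (2 * eigval i)) =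
        2 * (eigval i * (u \<bullet> e_basis i)\<^sup>2 / q i)"
      using l qi by (simp add: a_def field_simps power2_eq_square)
    ultimately show "2 * (eigval i * (u \<bullet> e_basis i)\<^sup>2 / q i) \<le>
        2 * a i * (u \<bullet> e_basis i) - (a i)\<^sup>2 * q i * v i" by linarith
  qed
  also have "\<dots> = (LINT s|lborel. (\<Sum>i\<in>{1..n}. m i s))"
    by (rule has_bochner_integral_integral_eq[symmetric])
      (intro has_bochner_integral_sum m_int)
  also have "\<dots> \<le> energy T \<phi>"
    unfolding energy_def set_lebesgue_integral_def
  proof (rule integral_mono)
    show "integrable lborel (\<lambda>s. \<Sum>i\<in>{1..n}. m i s)"
      using m_int by (intro Bochner_Integration.integrable_sum) (auto simp: has_bochner_integral_iff)
    show "integrable lborel (\<lambda>s. indicat_real {0..T} s *\<^sub>R (norm (\<phi> s))\<^sup>2)"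
      using \<phi> by (simp add: L2_path_def set_integrable_def)
  qed (use pointwise in simp)
  finally show ?thesis .
qed

section \<open>Lower bounds for both rate functions\<close>

lemma ereal_le_half_mult:
  assumes "ereal (2 * x) \<le> y"
  shows "ereal x \<le> ereal (1 / 2) * y"
proof -
  have "ereal (1 / 2) * ereal (2 * x) \<le> ereal (1 / 2) * y"
    by (rule ereal_mult_left_mono[OF assms]) simp
  then show ?thesis by simp
qed

text \<open>The start at 0 removes the initial term, so the end point is exactly the integral
  treated in \<open>energy_ge_mode_cost\<close>. The bound holds for every \<open>n\<close> since
  modes beyond \<open>n\<close> are simply discarded.\<close>

lemma rate_V_ge_mode_cost:
  assumes F: "\<And>v. F v = 0" and q: "\<And>i. i \<ge> 1 \<Longrightarrow> q i > 0"
    and op: "\<And>i v. i \<ge> 1 \<Longrightarrow> op_sqrt Q v \<bullet> e_basis i = sqrt (q i) * (v \<bullet> e_basis i)"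
  shows "ereal (mode_cost q n u) \<le> rate_V F Q u"
  unfolding rate_V_def
proof (rule Inf_greatest, clarify)
  fix T :: real and z :: "real \<Rightarrow> L2"
  assume T: "T > 0"
  show "ereal (mode_cost q n (z T)) \<le> path_rate F Q T 0 z"
    unfolding path_rate_def
  proof (rule ereal_le_half_mult, rule Inf_greatest, clarify)
    fix \<phi> assume \<phi>: "L2_path T \<phi>" and mild: "mild_solution F Q T 0 \<phi> z"
    let ?G = "\<lambda>s. heat_semigroup (T - s) (F (z s) + op_sqrt Q (\<phi> s))"
    have "heat_semigroup T 0 = 0" by (simp add: heat_semigroup_def spectral_def)
    then have "set_integrable lborel {0..T} ?G" "z T = (LINT s:{0..T}|lborel. ?G s)"
      using mild T by (auto simp: mild_solution_def)
    then have "2 * mode_cost q n (z T) \<le> energy T \<phi>"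
      using T by (intro energy_ge_mode_cost[where G = ?G] \<phi> q) (simp_all add: F op inner_heat_semigroup)
    then show "ereal (2 * mode_cost q n (z T)) \<le> ereal (energy T \<phi>)" by simp
  qed
qed

text \<open>With \<open>F = 0\<close> the values at the grid points drop out, which makes the bound
  independent of \<open>\<tau>\<close>; the projection leaves the first \<open>n\<close>
  coefficients unchanged.\<close>

lemma rate_V_fin_ge_mode_cost:
  assumes F: "\<And>v. F v = 0" and q: "\<And>i. i \<ge> 1 \<Longrightarrow> q i > 0"
    and op: "\<And>i v. i \<ge> 1 \<Longrightarrow> op_sqrt Q v \<bullet> e_basis i = sqrt (q i) * (v \<bullet> e_basis i)"
  shows "ereal (mode_cost q n u) \<le> rate_V_fin F Q n \<tau> u"
  unfolding rate_V_fin_def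
proof (rule Inf_greatest, clarify)
  fix T :: real and z :: "real \<Rightarrow> L2"
  assume T: "T > 0"
  show "ereal (mode_cost q n (z T)) \<le> path_rate_fin F Q n \<tau> T 0 z"
    unfolding path_rate_fin_def
  proof (rule ereal_le_half_mult, rule Inf_greatest, clarify)
    fix \<phi> assume \<phi>: "L2_path T \<phi>" and mild: "mild_solution_fin F Q n \<tau> T 0 \<phi> z"
    let ?G = "\<lambda>s. semigroup_fin n (T - s)
       (proj n (F (z (\<tau> * of_int \<lfloor>s / \<tau>\<rfloor>))) + proj n (op_sqrt Q (\<phi> s)))"
    have "proj n 0 = 0" by (simp add: proj_eq)
    then have G: "?G s = semigroup_fin n (T - s) (proj n (op_sqrt Q (\<phi> s)))" for s
      by (simp add: F)
    have "semigroup_fin n T 0 = 0"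
      using semigroup_fin_H_fin[of 0 n T] by (simp add: H_fin_def span_zero)
    then have "set_integrable lborel {0..T} ?G" "z T = (LINT s:{0..T}|lborel. ?G s)"
      using mild T by (auto simp: mild_solution_fin_def)
    moreover have "?G s \<bullet> e_basis i = exp (- eigval i * (T - s)) * (sqrt (q i) * (\<phi> s \<bullet> e_basis i))"
      if "i \<in> {1..n}" for i s
      unfolding G inner_semigroup_fin[OF proj_in_H_fin that] inner_proj[OF that] using that by (simp add: op)
    ultimately have "2 * mode_cost q n (z T) \<le> energy T \<phi>"
      using T by (intro energy_ge_mode_cost[where G = ?G] \<phi> q) simp_all
    then show "ereal (2 * mode_cost q n (z T)) \<le> ereal (energy T \<phi>)" by simp
  qed
qed

text \<open>
  The control is the minimiser on \<open>[0, T]\<close>: in each mode it is proportional to the adjoint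
  semigroup \<open>exp (- eigval i * (T - s))\<close>, which is the equality case of Cauchy--Schwarz.
\<close>

lemma rate_V_fin_le:
  assumes F: "\<And>v. F v = 0" and q: "\<And>i. i \<ge> 1 \<Longrightarrow> q i > 0"
    and op: "\<And>i v. i \<ge> 1 \<Longrightarrow> op_sqrt Q v \<bullet> e_basis i = sqrt (q i) * (v \<bullet> e_basis i)"
    and u: "u \<in> H_fin n" and T: "T > 0"
  shows "rate_V_fin F Q n \<tau> u \<le> ereal (mode_cost q n u / (1 - exp (- eigval 1 * (T + T))))"
proof -
  define D where "D i = 1 - exp (- eigval i * (T + T))" for i
  \<comment> \<open>Solves \<open>sqrt (q i) * c i * D i / (2 * eigval i) = u \<bullet> e_basis
    i\<close>, so that the trajectory reaches \<open>u\<close> at time \<open>T\<close>.\<close>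
  define c where "c i = 2 * eigval i * (u \<bullet> e_basis i) / (sqrt (q i) * D i)" for i
  \<comment> \<open>The response of mode \<open>i\<close> at time \<open>t\<close> to the unit
    control \<open>exp (- eigval i * (T - s))\<close> without noise factor.\<close>
  define E where "E i t = (exp (- eigval i * (T - t)) - exp (- eigval i * (T + t))) / (2 * eigval i)" for i t
  define \<phi> where "\<phi> s = (\<Sum>i\<in>{1..n}. (c i * exp (- eigval i * (T - s))) *\<^sub>R e_basis i)" for s
  define z where "z t = (\<Sum>i\<in>{1..n}. (E i t * (sqrt (q i) * c i)) *\<^sub>R e_basis i)" for t
  have D: "D i > 0" if "i \<ge> 1" for i using eigval_pos[OF that] T by (simp add: D_def mult_pos_pos)
  have ET: "E i T = D i / (2 * eigval i)" for i by (simp add: E_def D_def)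
  have zT: "z T = u"
  proof -
    have "E i T * (sqrt (q i) * c i) = u \<bullet> e_basis i" if "i \<in> {1..n}" for i
      using that D[of i] q[of i] eigval_pos[of i] by (simp add: ET c_def)
    then have "z T = (\<Sum>i\<in>{1..n}. (u \<bullet> e_basis i) *\<^sub>R e_basis i)"
      unfolding z_def by (intro sum.cong) auto
    then show ?thesis using H_fin_expansion[OF u] by simp
  qed
  have z0: "z 0 = 0" by (simp add: z_def E_def)
  have cz: "continuous_on {0..T} z"
    unfolding z_def E_def using eigval_pos by (intro continuous_intros) force
  have c\<phi>: "continuous_on UNIV \<phi>" unfolding \<phi>_def by (intro continuous_intros)
  have path: "L2_path T \<phi>"
    unfolding L2_path_def
  proof
    show "set_borel_measurable lborel {0..T} \<phi>"
      using borel_measurable_continuous_onI[OF c\<phi>]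
      by (simp add: set_borel_measurable_def)
    show "set_integrable lborel {0..T} (\<lambda>s. (norm (\<phi> s))\<^sup>2)"
      by (intro borel_integrable_atLeastAtMost' continuous_intros continuous_on_subset[OF c\<phi>]) simp
  qed
  have \<phi>_H: "\<phi> s \<in> H_fin n" and z_H: "z s \<in> H_fin n" for s
    unfolding \<phi>_def z_def by (rule sum_in_H_fin)+
  have mild: "mild_solution_fin F Q n \<tau> T 0 \<phi> z"
    unfolding mild_solution_fin_def
  proof
    fix t assume t: "t \<in> {0..T}"
    have "proj n 0 = 0" by (simp add: proj_eq)
    have G: "semigroup_fin n (t - s) (proj n (F (z (\<tau> * of_int \<lfloor>s / \<tau>\<rfloor>))) + proj n (op_sqrt Q (\<phi> s))) =
        (\<Sum>i\<in>{1..n}. (exp (- eigval i * (t - s)) * exp (- eigval i * (T - s)) * (sqrt (q i) * c i)) *\<^sub>R e_basis i)"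
      for s
    proof -
      have "\<phi> s \<bullet> e_basis i = c i * exp (- eigval i * (T - s))" if "i \<in> {1..n}" for i
        unfolding \<phi>_def using that by (subst inner_sum_e_basis) auto
      then show ?thesis
        unfolding F \<open>proj n 0 = 0\<close> add_0_left semigroup_fin_H_fin[OF proj_in_H_fin]
        by (intro sum.cong refl) (simp add: inner_proj op mult_ac)
    qed
    have "has_bochner_integral lborel (\<lambda>s. \<Sum>i\<in>{1..n}.
        (indicat_real {0..t} s * (exp (- eigval i * (t - s)) * exp (- eigval i * (T - s))) * (sqrt (q i) * c i)) *\<^sub>R e_basis i)
        (z t)"
      unfolding z_def E_def
    proof (intro has_bochner_integral_sum has_bochner_integral_scaleR_left has_bochner_integral_mult_left
        has_bochner_integral_exp_mult_exp)
      fix i assume "i \<in> {1..n}"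
      then show "eigval i \<noteq> 0" using eigval_pos[of i] by simp
    qed (use t in simp)
    moreover have "semigroup_fin n t 0 = 0"
      using semigroup_fin_H_fin[of 0 n t] by (simp add: H_fin_def span_zero)
    ultimately show "set_integrable lborel {0..t} (\<lambda>s. semigroup_fin n (t - s)
         (proj n (F (z (\<tau> * of_int \<lfloor>s / \<tau>\<rfloor>))) + proj n (op_sqrt Q (\<phi> s)))) \<and>
       z t = semigroup_fin n t 0 + (LINT s:{0..t}|lborel. semigroup_fin n (t - s)
         (proj n (F (z (\<tau> * of_int \<lfloor>s / \<tau>\<rfloor>))) + proj n (op_sqrt Q (\<phi> s))))"
      unfolding G set_integrable_def set_lebesgue_integral_def
      by (simp add: has_bochner_integral_iff scaleR_sum_right mult.assoc)
  qed
  have "energy T \<phi> = (\<Sum>i\<in>{1..n}. (c i)\<^sup>2 * E i T)"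
    unfolding energy_def set_lebesgue_integral_def
  proof (rule has_bochner_integral_integral_eq)
    have "indicat_real {0..T} s *\<^sub>R (norm (\<phi> s))\<^sup>2 = (\<Sum>i\<in>{1..n}. (c i)\<^sup>2 *
        (indicat_real {0..T} s * (exp (- eigval i * (T - s)) * exp (- eigval i * (T - s)))))" for s
      unfolding \<phi>_def
      by (subst norm_sum_e_basis)
        (auto simp: sum_distrib_left power2_eq_square mult_ac intro!: sum.cong)
    moreover have "has_bochner_integral lborel (\<lambda>s. \<Sum>i\<in>{1..n}. (c i)\<^sup>2 *
        (indicat_real {0..T} s * (exp (- eigval i * (T - s)) * exp (- eigval i * (T - s)))))
        (\<Sum>i\<in>{1..n}. (c i)\<^sup>2 * E i T)"
      unfolding E_def
    proof (intro has_bochner_integral_sum has_bochner_integral_mult_right has_bochner_integral_exp_mult_exp)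
      fix i assume "i \<in> {1..n}"
      then show "eigval i \<noteq> 0" using eigval_pos[of i] by simp
    qed (use T in simp)
    ultimately show "has_bochner_integral lborel (\<lambda>s. indicat_real {0..T} s *\<^sub>R (norm (\<phi> s))\<^sup>2)
        (\<Sum>i\<in>{1..n}. (c i)\<^sup>2 * E i T)" by presburger
  qed
  also have "\<dots> \<le> 2 * (mode_cost q n u / D 1)"
    unfolding mode_cost_def sum_divide_distrib sum_distrib_left
  proof (rule sum_mono)
    fix i assume i: "i \<in> {1..n}"
    then have l: "eigval i > 0" and qi: "q i > 0" and Di: "D i > 0"
      using eigval_pos[of i] q[of i] D[of i] by auto
    \<comment> \<open>The slowest mode has the smallest \<open>D\<close>, so the single factor
      \<open>D 1\<close> serves for all modes.\<close>
    have "eigval 1 \<le> eigval i"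
      using i unfolding eigval_def by (intro mult_left_mono power_mono) auto
    then have D1: "D 1 \<le> D i" using T by (simp add: D_def mult_right_mono)
    have "(c i)\<^sup>2 * E i T = 2 * (eigval i * (u \<bullet> e_basis i)\<^sup>2 / q i / D i)"
      using l qi Di by (simp add: c_def ET power_divide power_mult_distrib field_simps power2_eq_square)
    also have "\<dots> \<le> 2 * (eigval i * (u \<bullet> e_basis i)\<^sup>2 / q i / D 1)"
      using D1 D[of 1] l qi by (intro mult_left_mono divide_left_mono) auto
    finally show "(c i)\<^sup>2 * E i T \<le> 2 * (eigval i * (u \<bullet> e_basis i)\<^sup>2 / q i / D 1)" .
  qed
  finally have en: "energy T \<phi> \<le> 2 * (mode_cost q n u / D 1)" .
  have "rate_V_fin F Q n \<tau> u \<le> path_rate_fin F Q n \<tau> T 0 z"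
    unfolding rate_V_fin_def using T cz z_H z0 zT by (intro Inf_lower) auto
  also have "\<dots> \<le> ereal (1 / 2) * ereal (energy T \<phi>)"
    unfolding path_rate_fin_def using path \<phi>_H mild
    by (intro ereal_mult_left_mono Inf_lower) auto
  also have "\<dots> \<le> ereal (mode_cost q n u / D 1)" using en by (simp add: mult.commute)
  finally show ?thesis by (simp add: D_def)
qed

text \<open>Letting the horizon \<open>T = k\<close> grow sends the correction factor to 1; as
  powers of a fixed number below 1, the exponentials tend to 0.\<close>

lemma rate_V_fin_le_mode_cost:
  assumes F: "\<And>v. F v = 0" and q: "\<And>i. i \<ge> 1 \<Longrightarrow> q i > 0"
    and op: "\<And>i v. i \<ge> 1 \<Longrightarrow> op_sqrt Q v \<bullet> e_basis i = sqrt (q i) * (v \<bullet> e_basis i)"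
    and u: "u \<in> H_fin n"
  shows "rate_V_fin F Q n \<tau> u \<le> ereal (mode_cost q n u)"
proof (rule LIMSEQ_le_const)
  have x: "\<bar>exp (- 2 * eigval 1)\<bar> < 1" using eigval_pos[of 1] by simp
  have "(\<lambda>k. 1 - exp (- 2 * eigval 1) ^ k) \<longlonglongrightarrow> 1 - 0"
    using x by (intro tendsto_diff tendsto_const LIMSEQ_power_zero) simp
  then have "(\<lambda>k. mode_cost q n u / (1 - exp (- 2 * eigval 1) ^ k)) \<longlonglongrightarrow> mode_cost q n u / 1"
    by (intro tendsto_divide tendsto_const) simp_all
  moreover have "exp (- 2 * eigval 1) ^ k = exp (- eigval 1 * (real k + real k))" for k
    unfolding exp_of_nat_mult[symmetric] by (simp add: algebra_simps)
  ultimately show "(\<lambda>k. ereal (mode_cost q n u / (1 - exp (- eigval 1 * (real k + real k))))) \<longlonglongrightarrow>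
      ereal (mode_cost q n u)" by simp
  \<comment> \<open>The bound needs a positive horizon, so the sequence is compared from
    \<open>k = 1\<close> on.\<close>
  show "\<exists>N. \<forall>k\<ge>N. rate_V_fin F Q n \<tau> u \<le> ereal (mode_cost q n u / (1 - exp (- eigval 1 * (real k + real k))))"
    using rate_V_fin_le[where F = F and q = q and Q = Q, OF F q op u] by (intro exI[of _ 1]) auto
qed

section \<open>Approximation of u by a point of exactly equal cost\<close>

theorem theorem4p7:
  fixes Q F :: "L2 \<Rightarrow> L2" and q :: "nat \<Rightarrow> real" and L\<^sub>F L \<tau>\<^sub>0 :: real
  assumes Q_bounded: "bounded_linear Q"
    and Q_self_adjoint: "self_adjoint Q"
    and Q_positive: "positive_definite Q"
    and Q_eigen: "\<And>i. i \<ge> 1 \<Longrightarrow> q i > 0 \<and> Q (e_basis i) = q i *\<^sub>R e_basis i"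
    and dom_A: "lap_dom \<subseteq> op_inv_sqrt_dom Q"
    and HS_dom: "range (op_sqrt Q) \<subseteq> frac_dom (1 / 2)"
    and HS: "hilbert_schmidt (\<lambda>u. frac_pow (1 / 2) (op_sqrt Q u))"
    and QA_bounded: "bounded_linear (\<lambda>u. op_inv_sqrt Q (frac_pow (- 1) u))"
    and F_diff: "\<And>u. F differentiable (at u)"
    and L_pos: "L\<^sub>F > 0" "L > 0"
    and F_Lipschitz: "\<And>u v. norm (F u - F v) \<le> L\<^sub>F * norm (u - v)"
    and F_H1: "\<And>u. u \<in> Hdot 1 \<Longrightarrow> F u \<in> Hdot 1 \<and> Hdot_norm 1 (F u) \<le> L * (1 + Hdot_norm 1 u)"
    and F'_H2: "\<And>u v. u \<in> Hdot 2 \<Longrightarrow> v \<in> Hdot 2 \<Longrightarrow>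
      frechet_derivative F (at u) v \<in> Hdot 2 \<and>
      Hdot_norm 2 (frechet_derivative F (at u) v) \<le> L * (1 + (Hdot_norm 2 u)\<^sup>2) * Hdot_norm 2 v"
    and F_0: "F 0 = 0"
    and L\<^sub>F_less: "L\<^sub>F < eigval 1"
    and \<tau>\<^sub>0_pos: "\<tau>\<^sub>0 > 0"
    and \<tau>\<^sub>0_eq: "(exp (eigval 1 * \<tau>\<^sub>0) - 1) / (eigval 1 * \<tau>\<^sub>0) = (eigval 1 + L\<^sub>F) / (2 * L\<^sub>F)"
    and F_zero: "\<And>u. F u = 0"
  shows "\<forall>\<kappa>>0. \<forall>u. rate_V F Q u < \<infinity> \<longrightarrow>
    (\<exists>n\<ge>1. \<exists>\<tau>. 0 < \<tau> \<and> \<tau> \<le> \<tau>\<^sub>0 \<and> (\<exists>u'\<in>H_fin n.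
      norm (u - u') < \<kappa> \<and> \<bar>rate_V F Q u - rate_V_fin F Q n \<tau> u'\<bar> < ereal \<kappa>))"
proof (intro allI impI)
  fix \<kappa> :: real and u
  assume \<kappa>: "\<kappa> > 0" and fin: "rate_V F Q u < \<infinity>"
  have q: "i \<ge> 1 \<Longrightarrow> q i > 0" for i using Q_eigen by blast
  have op: "i \<ge> 1 \<Longrightarrow> op_sqrt Q v \<bullet> e_basis i = sqrt (q i) * (v \<bullet> e_basis i)" for i v
    by (rule op_sqrt_e_basis[OF Q_bounded Q_self_adjoint Q_eigen])
  have lower: "ereal (mode_cost q n u) \<le> rate_V F Q u" for n
    by (rule rate_V_ge_mode_cost[OF F_zero q op])
  \<comment> \<open>With no modes the cost is an empty sum, so the rate function is nonnegative and,
    being finite, a real number.\<close>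
  have "rate_V F Q u \<noteq> - \<infinity>" using lower[of 0] by auto
  then obtain v where v: "rate_V F Q u = ereal v"
    using fin by (cases "rate_V F Q u") auto
  \<comment> \<open>One half of the tolerance goes to the projection error, the other half to the
    added mode.\<close>
  obtain n where n: "norm (u - proj n u) < \<kappa> / 2"
    using LIMSEQ_D[OF proj_tendsto[of u], of "\<kappa> / 2"] \<kappa> by (auto simp: norm_minus_commute)
  define r where "r = v - mode_cost q n u"
  have r: "r \<ge> 0" using lower[of n] by (simp add: v r_def)
  have B: "q i \<le> onorm Q" if "i \<ge> 1" for i
    using eigenvalue_le_onorm[OF Q_bounded that] Q_eigen[OF that] by simp
  \<comment> \<open>Since \<open>q N \<le> onorm Q\<close> and \<open>real N \<le> eigval N\<close>,
    any \<open>N > M\<close> makes \<open>r * q N / eigval N\<close> smaller than the square of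
    \<open>\<kappa> / 2\<close>.\<close>
  obtain M :: nat where M: "r * onorm Q / (\<kappa> / 2)\<^sup>2 < real M"
    using reals_Archimedean2 by blast
  \<comment> \<open>A high mode of vanishing norm absorbs the missing cost \<open>r\<close>, since \<open>q i / eigval i\<close> tends to 0.\<close>
  define N where "N = Suc (max n M)"
  define \<delta> where "\<delta> = sqrt (r * q N / eigval N)"
  define u' where "u' = proj n u + \<delta> *\<^sub>R e_basis N"
  have N: "N \<ge> 1" "n < N" "real M \<le> real N" by (auto simp: N_def)
  have qN: "q N > 0" and lN: "eigval N > 0" using q[of N] eigval_pos[of N] N by auto
  have \<delta>: "0 \<le> \<delta>" "\<delta>\<^sup>2 = r * q N / eigval N" using r qN lN by (auto simp: \<delta>_def)
  have "\<delta>\<^sup>2 < (\<kappa> / 2)\<^sup>2"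
  proof -
    have "real N * 1 \<le> pi\<^sup>2 * (real N * real N)"
    proof -
      have "1 \<le> pi\<^sup>2" using pi_ge_two by (intro one_le_power) simp
      moreover have "real N * 1 \<le> real N * real N" using N by (intro mult_left_mono) auto
      ultimately show ?thesis using mult_mono[of 1 "pi\<^sup>2" "real N" "real N * real N"] by simp
    qed
    then have "real N \<le> eigval N" by (simp add: eigval_def power2_eq_square)
    then have "r * onorm Q / (\<kappa> / 2)\<^sup>2 < eigval N" using M N by linarith
    then have "r * onorm Q / eigval N < (\<kappa> / 2)\<^sup>2"
      using \<kappa> lN by (simp add: field_simps)
    moreover have "r * q N / eigval N \<le> r * onorm Q / eigval N"
      using r lN B[of N] N by (intro divide_right_mono mult_left_mono) auto
    ultimately show ?thesis by (simp add: \<delta>)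
  qed
  then have "\<delta> < \<kappa> / 2" by (rule power2_less_imp_less) (use \<kappa> in simp)
  have "norm (u - u') \<le> norm (u - proj n u) + norm (\<delta> *\<^sub>R e_basis N)"
    using norm_triangle_ineq4[of "u - proj n u" "\<delta> *\<^sub>R e_basis N"] by (simp add: u'_def algebra_simps)
  also have "\<dots> < \<kappa>" using n \<open>\<delta> < \<kappa> / 2\<close> \<delta>(1) N by (simp add: norm_e_basis)
  finally have dist: "norm (u - u') < \<kappa>" .
  have u'_H: "u' \<in> H_fin N"
  proof -
    have "H_fin n \<subseteq> H_fin N" unfolding H_fin_def using N by (intro span_mono image_mono) auto
    then have "proj n u \<in> H_fin N" using proj_in_H_fin by blast
    moreover have "e_basis N \<in> H_fin N" unfolding H_fin_def using N by (intro span_base) auto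
    ultimately show ?thesis unfolding u'_def H_fin_def by (intro span_add span_scale)
  qed
  have coeff: "u' \<bullet> e_basis i = (if i \<le> n then u \<bullet> e_basis i else if i = N then \<delta> else 0)"
    if "i \<ge> 1" for i
    using that N inner_sum_e_basis[of "{1..n}" i "\<lambda>i. u \<bullet> e_basis i"]
    by (auto simp: u'_def inner_add_left inner_e_basis proj_eq)
  \<comment> \<open>Coefficients strictly between \<open>n\<close> and \<open>N\<close> vanish, so
    only the old modes and the new mode \<open>N\<close> contribute; the latter contributes exactly
    \<open>r\<close>.\<close>
  have "mode_cost q N u' = (\<Sum>i\<in>{1..n} \<union> {N}. eigval i * (u' \<bullet> e_basis i)\<^sup>2 / q i)"
    unfolding mode_cost_def using N by (intro sum.mono_neutral_right) (auto simp: coeff)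
  also have "\<dots> = mode_cost q n u + eigval N * \<delta>\<^sup>2 / q N"
    using N by (subst sum.union_disjoint) (auto simp: mode_cost_def coeff intro!: sum.cong)
  also have "\<dots> = v" using qN lN by (simp add: \<delta>(2) r_def)
  finally have cost: "mode_cost q N u' = v" .
  \<comment> \<open>The two bounds for the discrete rate function coincide for every stepsize, so
    \<open>\<tau>\<^sub>0\<close> may serve as witness and the two rates agree exactly.\<close>
  have "rate_V_fin F Q N \<tau>\<^sub>0 u' = ereal v"
    using rate_V_fin_ge_mode_cost[where n = N and u = u' and \<tau> = \<tau>\<^sub>0, OF F_zero q op]
      rate_V_fin_le_mode_cost[where \<tau> = \<tau>\<^sub>0, OF F_zero q op u'_H] cost by (intro antisym) auto
  then show "\<exists>n\<ge>1. \<exists>\<tau>. 0 < \<tau> \<and> \<tau> \<le> \<tau>\<^sub>0 \<and> (\<exists>u'\<in>H_fin n.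
      norm (u - u') < \<kappa> \<and> \<bar>rate_V F Q u - rate_V_fin F Q n \<tau> u'\<bar> < ereal \<kappa>)"
    using N \<tau>\<^sub>0_pos u'_H dist \<kappa> v by (intro exI[of _ N] conjI exI[of _ \<tau>\<^sub>0] bexI[of _ u']) auto
qed

end
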